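(* Let $C\subseteq L\cong\mathbb{P}^r\subseteq\mathbb{P}^n$ be a rational normal curve of degree $r$, let $j:\mathbb{P}^1\to C$ be an isomorphism, let $\mu:\mathcal{O}_{\mathbb{P}^1}^{r-1}(-r-2)\oplus\mathcal{O}_{\mathbb{P}^1}^{n-r}(-r)\to\mathcal{O}_{\mathbb{P}^1}(-r-2+a)$ be a surjective map, and let $X$ be the double structure on $C$ associated to $\mu$. Then the homogeneous ideal $I_X=I_C^2+[I_C]M$, where $M$ is a matrix constructed from $\mu$ as described in the context, is saturated.
   Context: $K$ is an algebraically closed field of characteristic $0$, $R=K[x_0,\dots,x_n]$, $\mathbb{P}^n=\operatorname{Proj}R$. A rational normal curve of degree $r\le n$ in $\mathbb{P}^n$ is the image of the degree $r$ Veronese embedding $\mathbb{P}^1\to\mathbb{P}^r$ followed by a linear embedding $\mathbb{P}^r\to\mathbb{P}^n$ with image $L$. Coordinates are chosen so that $L=V(x_{r+1},\dots,x_n)$, $C\subset L$ is defined by the $2\times 2$ minors $f_{pq}=x_{p-1}x_q-x_px_{q-1}$ ($1\le p<q\le r$) of $\begin{pmatrix} x_0 & x_1 & \cdots & x_{r-1} \\ x_1 & x_2 & \cdots & x_r \end{pmatrix}$, and $j(t:u)=(t^r:t^{r-1}u:\cdots:u^r:0:\cdots:0)$. The saturated ideal $I_C\subset R$ is generated by the $f_{pq}$ and $x_{r+1},\dots,x_n$. Let $e_1,\dots,e_r$ and $g_1,\dots,g_{r-1}$ be the canonical bases of $\mathcal{O}_{\mathbb{P}^1}^r(-r)$ and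 $\mathcal{O}_{\mathbb{P}^1}^{r-1}(-r-2)$, and let $\psi:\wedge^2\mathcal{O}_{\mathbb{P}^1}^r(-r)\to\mathcal{O}_{\mathbb{P}^1}^{r-1}(-r-2)$ be $\psi(e_p\wedge e_q)=\sum_{h=p}^{q-1}t^{r-h-1}u^{h-1}g_{p+q-1-h}$. The sheaf $j^*(\mathcal{I}_C/\mathcal{I}_C^2)$ is identified with $\mathcal{O}_{\mathbb{P}^1}^{r-1}(-r-2)\oplus\mathcal{O}_{\mathbb{P}^1}^{n-r}(-r)$ so that the class of $f_{pq}$ is $\psi(e_p\wedge e_q)$ and the class of $x_{r+i}$ is the $i$-th canonical basis element of the second summand. The double structure $X$ associated to $\mu$ is the curve with ideal sheaf $\mathcal{I}_X$, $\mathcal{I}_C^2\subseteq\mathcal{I}_X\subseteq\mathcal{I}_C$, such that $\mathcal{I}_X/\mathcal{I}_C^2$ is the kernel of the surjection $\mathcal{I}_C/\mathcal{I}_C^2\to\mathcal{L}:=j_*\mathcal{O}_{\mathbb{P}^1}(-r-2+a)$ corresponding to $\mu$. Construction of $M$: write $H^0_*(C,\mathcal{F})=\bigoplus_{i\in\mathbb{Z}}H^0(C,\mathcal{F}(i))$; then $H^0_*(C,\mathcal{O}_C)=R/I_C$. Consider the map of graded $R/I_C$-modules $$H^0_*(j_*(\mu\circ(\psi\oplus\mathrm{id}))):\ H^0_*\big(C,\wedge^2\mathcal{O}_C^r(-1)\oplus\mathcal{O}_C^{n-r}(-1)\big)\to H^0_*(C,\mathcal{L}).$$ Choose a free graded $R/I_C$-module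 $F_1$ and a homogeneous map $\nu$ from $F_1$ to the source of this map such that the image of $\nu$ is the kernel of this map; let $N$ be a matrix representing $\nu$, and let $M$ be a lifting of $N$ to a matrix of homogeneous polynomials over $R$ via $R\to R/I_C$. Let $[I_C]$ be the row matrix whose entries are the generators $f_{pq}$, $x_{r+1},\dots,x_n$ of $I_C$, in the order corresponding to the basis $e_p\wedge e_q$ of $\wedge^2\mathcal{O}_C^r(-1)$ and the canonical basis of $\mathcal{O}_C^{n-r}(-1)$. Then $I_C^2+[I_C]M$ denotes the ideal of $R$ generated by $I_C^2$ and the entries of the row matrix $[I_C]M$; it defines the scheme $X$. *)

theory Defs
  imports
    "HOL-Library.Poly_Mapping"
    "HOL-Library.FuncSet"
    "HOL-Computational_Algebra.Polynomial_Factorial"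
    "HOL-Algebra.QuotRing"
    "HOL-Algebra.Ideal_Product"
begin

text \<open>
  Polynomials in the variables \<open>x\<^sub>0, x\<^sub>1, \<dots>\<close>; the ring \<open>K[x\<^sub>0,\<dots>,x\<^sub>n]\<close> is the carrier of \<open>poly_ring n\<close>.
  In particular \<open>poly_ring 1\<close> is the coordinate ring \<open>K[t,u]\<close> of \<open>\<bbbP>\<^sup>1\<close>, with \<open>t = x\<^sub>0\<close> and \<open>u = x\<^sub>1\<close>.
\<close>

type_synonym 'k mpoly = "(nat \<Rightarrow>\<^sub>0 nat) \<Rightarrow>\<^sub>0 'k"

definition Var :: "nat \<Rightarrow> 'k::field mpoly" where
  "Var i = Poly_Mapping.single (Poly_Mapping.single i 1) 1"

definition Const :: "'k::field \<Rightarrow> 'k mpoly" where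
  "Const c = Poly_Mapping.single 0 c"

abbreviation tt :: "'k::field mpoly" where "tt \<equiv> Var 0"
abbreviation uu :: "'k::field mpoly" where "uu \<equiv> Var 1"

text \<open>Evaluation at \<open>x\<^sub>i \<mapsto> \<sigma> i\<close>, the coefficients being mapped by \<open>c\<close>.\<close>
definition mpoly_eval ::
    "('k::field \<Rightarrow> 'b::comm_semiring_1) \<Rightarrow> (nat \<Rightarrow> 'b) \<Rightarrow> 'k mpoly \<Rightarrow> 'b" where
  "mpoly_eval c \<sigma> F = (\<Sum>m\<in>Poly_Mapping.keys F. c (Poly_Mapping.lookup F m) *
      (\<Prod>i\<in>Poly_Mapping.keys m. \<sigma> i ^ Poly_Mapping.lookup m i))"

definition poly_ring :: "nat \<Rightarrow> ('k::field mpoly) ring" where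
  "poly_ring n = \<lparr> carrier = {F. \<forall>m\<in>Poly_Mapping.keys F. Poly_Mapping.keys m \<subseteq> {..n}},
     mult = (*), one = 1, zero = 0, add = (+) \<rparr>"

definition mon_deg :: "(nat \<Rightarrow>\<^sub>0 nat) \<Rightarrow> nat" where
  "mon_deg m = (\<Sum>i\<in>Poly_Mapping.keys m. Poly_Mapping.lookup m i)"

text \<open>The graded piece \<open>K[x\<^sub>0,\<dots>,x\<^sub>n]\<^sub>d\<close>; it is \<open>{0}\<close> for \<open>d < 0\<close>.\<close>
definition forms :: "nat \<Rightarrow> int \<Rightarrow> 'k::field mpoly set" where
  "forms n d =
     {F \<in> carrier (poly_ring n). \<forall>m\<in>Poly_Mapping.keys F. int (mon_deg m) = d}"

definition hom_comp :: "nat \<Rightarrow> 'k::field mpoly \<Rightarrow> 'k mpoly" where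
  "hom_comp d F = (\<Sum>m\<in>{m \<in> Poly_Mapping.keys F. mon_deg m = d}.
      Poly_Mapping.single m (Poly_Mapping.lookup F m))"

definition homogeneous_ideal :: "nat \<Rightarrow> 'k::field mpoly set \<Rightarrow> bool" where
  "homogeneous_ideal n I \<longleftrightarrow> ideal I (poly_ring n) \<and> (\<forall>F\<in>I. \<forall>d. hom_comp d F \<in> I)"

definition saturation :: "nat \<Rightarrow> 'k::field mpoly set \<Rightarrow> 'k mpoly set" where
  "saturation n I = {F \<in> carrier (poly_ring n). \<forall>i\<le>n. \<exists>k. Var i ^ k * F \<in> I}"

definition saturated :: "nat \<Rightarrow> 'k::field mpoly set \<Rightarrow> bool" where
  "saturated n I \<longleftrightarrow> saturation n I = I"

text \<open>
  A closed point of \<open>\<bbbP>\<^sup>n\<close> is given by any vector of homogeneous coordinates (filled up with zeros);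
  everything below is invariant under rescaling this vector.
\<close>
definition points :: "nat \<Rightarrow> (nat \<Rightarrow> 'k::field) set" where
  "points n = {P. (\<exists>i\<le>n. P i \<noteq> 0) \<and> (\<forall>i>n. P i = 0)}"

definition eval_at :: "(nat \<Rightarrow> 'k::field) \<Rightarrow> 'k mpoly \<Rightarrow> 'k" where
  "eval_at P = mpoly_eval (\<lambda>c. c) P"

text \<open>
  The stalk at \<open>P\<close> of \<open>\<O>(d)\<close> on \<open>\<bbbP>\<^sup>n\<close>: fractions of forms, homogeneous of degree \<open>d\<close>, whose
  denominator does not vanish at \<open>P\<close>. All sheaves used here are subsheaves of (sums of) the
  \<open>\<O>(d)\<close>, hence of constant sheaves of rational functions, and are given by their stalks
  at the closed points.
\<close>
definition stalk :: "nat \<Rightarrow> int \<Rightarrow> (nat \<Rightarrow> 'k::field) \<Rightarrow> 'k mpoly fract set" where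
  "stalk n d P = {to_fract F / to_fract G | F G e.
      F \<in> forms n (e + d) \<and> G \<in> forms n e \<and> eval_at P G \<noteq> 0}"

text \<open>The stalk at \<open>P\<close> of the ideal sheaf on \<open>\<bbbP>\<^sup>n\<close> defined by a homogeneous ideal.\<close>
definition ideal_stalk ::
    "nat \<Rightarrow> 'k::field mpoly set \<Rightarrow> (nat \<Rightarrow> 'k) \<Rightarrow> 'k mpoly fract set" where
  "ideal_stalk n I P = {to_fract F / to_fract G | F G e.
      F \<in> I \<inter> forms n e \<and> G \<in> forms n e \<and> eval_at P G \<noteq> 0}"

text \<open>The stalk at \<open>q\<close> of \<open>\<Oplus>\<^sub>\<alpha>\<^sub>\<in>\<^sub>A \<O>(d \<alpha>)\<close> on \<open>\<bbbP>\<^sup>1\<close>.\<close>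
definition sum_stalk ::
    "'i set \<Rightarrow> ('i \<Rightarrow> int) \<Rightarrow> (nat \<Rightarrow> 'k::field) \<Rightarrow> ('i \<Rightarrow> 'k mpoly fract) set" where
  "sum_stalk A d q = {s. (\<forall>\<alpha>\<in>A. s \<alpha> \<in> stalk 1 (d \<alpha>) q) \<and> (\<forall>\<alpha>. \<alpha> \<notin> A \<longrightarrow> s \<alpha> = 0)}"

text \<open>
  Morphisms of \<open>\<O>\<close>-modules \<open>\<Oplus>\<^sub>\<alpha>\<^sub>\<in>\<^sub>A \<O>(d \<alpha>) \<longrightarrow> \<O>(b)\<close> on \<open>\<bbbP>\<^sup>1\<close>. Since restriction maps are inclusions of
  rational functions, the maps on the stalks at different points agree on common elements; so a
  morphism is one function \<open>\<phi>\<close> that restricts at each point \<open>q\<close> to an \<open>\<O>\<^sub>q\<close>-linear map of the stalks.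
  (The value of \<open>\<phi>\<close> on vectors that belong to no stalk is irrelevant.)
\<close>
definition sheaf_hom :: "'i set \<Rightarrow> ('i \<Rightarrow> int) \<Rightarrow> int \<Rightarrow>
    (('i \<Rightarrow> 'k::field mpoly fract) \<Rightarrow> 'k mpoly fract) \<Rightarrow> bool" where
  "sheaf_hom A d b \<phi> \<longleftrightarrow> (\<forall>q\<in>points 1.
      (\<forall>s\<in>sum_stalk A d q. \<phi> s \<in> stalk 1 b q) \<and>
      (\<forall>s\<in>sum_stalk A d q. \<forall>s'\<in>sum_stalk A d q. \<phi> (\<lambda>\<alpha>. s \<alpha> + s' \<alpha>) = \<phi> s + \<phi> s') \<and>
      (\<forall>c\<in>stalk 1 0 q. \<forall>s\<in>sum_stalk A d q. \<phi> (\<lambda>\<alpha>. c * s \<alpha>) = c * \<phi> s))"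

definition sheaf_surj :: "'i set \<Rightarrow> ('i \<Rightarrow> int) \<Rightarrow> int \<Rightarrow>
    (('i \<Rightarrow> 'k::field mpoly fract) \<Rightarrow> 'k mpoly fract) \<Rightarrow> bool" where
  "sheaf_surj A d b \<phi> \<longleftrightarrow> (\<forall>q\<in>points 1. \<phi> ` sum_stalk A d q = stalk 1 b q)"

text \<open>
  \<open>\<phi> \<otimes> id\<close> on the twist by \<open>\<O>\<^bsub>\<bbbP>\<^sup>1\<^esub>(k)\<close>: on the dense open set \<open>t \<noteq> 0\<close> the sheaf \<open>\<O>(k)\<close> is free on \<open>t\<^sup>k\<close>.
\<close>
definition twist :: "int \<Rightarrow> (('i \<Rightarrow> 'k::field mpoly fract) \<Rightarrow> 'k mpoly fract) \<Rightarrow>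
    ('i \<Rightarrow> 'k mpoly fract) \<Rightarrow> 'k mpoly fract" where
  "twist k \<phi> s = to_fract tt powi k * \<phi> (\<lambda>\<alpha>. to_fract tt powi (- k) * s \<alpha>)"

text \<open>The map \<open>j(t:u) = (t\<^sup>r : t\<^sup>r\<^sup>-\<^sup>1u : \<dots> : u\<^sup>r : 0 : \<dots> : 0)\<close>.\<close>
definition j_coord :: "nat \<Rightarrow> nat \<Rightarrow> 'k::field mpoly" where
  "j_coord r i = (if i \<le> r then tt ^ (r - i) * uu ^ i else 0)"

definition pullback :: "nat \<Rightarrow> 'k::field mpoly \<Rightarrow> 'k mpoly" where
  "pullback r = mpoly_eval Const (j_coord r)"

definition rnc :: "nat \<Rightarrow> nat \<Rightarrow> (nat \<Rightarrow> 'k::field) set" where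
  "rnc n r = {P \<in> points n. \<exists>q\<in>points 1. \<exists>c. c \<noteq> 0 \<and> (\<forall>i. P i = c * eval_at q (j_coord r i))}"

definition minor :: "nat \<Rightarrow> nat \<Rightarrow> 'k::field mpoly" where
  "minor p q = Var (p - 1) * Var q - Var p * Var (q - 1)"

text \<open>
  The generators of \<open>I\<^sub>C\<close> and the basis of \<open>\<and>\<^sup>2\<O>\<^sub>C\<^sup>r(-1) \<oplus> \<O>\<^sub>C\<^sup>n\<^sup>-\<^sup>r(-1)\<close> have the same index set:
  \<open>Inl (p, q)\<close> stands for \<open>f\<^sub>p\<^sub>q\<close> and \<open>e\<^sub>p \<and> e\<^sub>q\<close>, while \<open>Inr i\<close> stands for \<open>x\<^sub>r\<^sub>+\<^sub>i\<close> and the \<open>i\<close>-th basis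
  element of the second summand. As \<open>\<and>\<^sup>2\<O>\<^sub>C\<^sup>r(-1)\<close> is free on the \<open>e\<^sub>p \<and> e\<^sub>q\<close> as a sum of copies of \<open>\<O>\<^sub>C(-2)\<close>,
  these basis elements have degree 2 and 1, respectively.
\<close>
definition gen_idx :: "nat \<Rightarrow> nat \<Rightarrow> (nat \<times> nat + nat) set" where
  "gen_idx n r = {(p, q). 1 \<le> p \<and> p < q \<and> q \<le> r} <+> {1..n - r}"

definition gen_deg :: "nat \<times> nat + nat \<Rightarrow> int" where
  "gen_deg \<alpha> = (case \<alpha> of Inl _ \<Rightarrow> 2 | Inr _ \<Rightarrow> 1)"

definition gen :: "nat \<Rightarrow> nat \<times> nat + nat \<Rightarrow> 'k::field mpoly" where
  "gen r \<alpha> = (case \<alpha> of Inl (p, q) \<Rightarrow> minor p q | Inr i \<Rightarrow> Var (r + i))"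

definition I_C :: "nat \<Rightarrow> nat \<Rightarrow> 'k::field mpoly set" where
  "I_C n r = Idl\<^bsub>poly_ring n\<^esub> (gen r ` gen_idx n r)"

text \<open>
  \<open>\<E> = \<O>\<^sup>r\<^sup>-\<^sup>1(-r-2) \<oplus> \<O>\<^sup>n\<^sup>-\<^sup>r(-r)\<close> on \<open>\<bbbP>\<^sup>1\<close>: \<open>Inl h\<close> is the index of \<open>g\<^sub>h\<close>, \<open>Inr i\<close> that of the \<open>i\<close>-th
  basis element of the second summand.
\<close>
definition E_idx :: "nat \<Rightarrow> nat \<Rightarrow> (nat + nat) set" where
  "E_idx n r = {1..r - 1} <+> {1..n - r}"

definition E_deg :: "nat \<Rightarrow> nat + nat \<Rightarrow> int" where
  "E_deg r \<beta> = (case \<beta> of Inl _ \<Rightarrow> - int r - 2 | Inr _ \<Rightarrow> - int r)"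

text \<open>The coefficient of \<open>g\<^sub>k\<close> in \<open>\<psi>(e\<^sub>p \<and> e\<^sub>q) = \<Sum>\<^sub>h t\<^sup>r\<^sup>-\<^sup>h\<^sup>-\<^sup>1u\<^sup>h\<^sup>-\<^sup>1 g\<^sub>p\<^sub>+\<^sub>q\<^sub>-\<^sub>1\<^sub>-\<^sub>h\<close>, where \<open>p \<le> h \<le> q - 1\<close>.\<close>
definition psi_coeff :: "nat \<Rightarrow> nat \<Rightarrow> nat \<Rightarrow> nat \<Rightarrow> 'k::field mpoly" where
  "psi_coeff r p q k =
     (\<Sum>h\<in>{p..q - 1}. if p + q - 1 - h = k then tt ^ (r - h - 1) * uu ^ (h - 1) else 0)"

text \<open>\<open>\<psi> \<oplus> id\<close>, on coordinate vectors.\<close>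
definition psi_id :: "nat \<Rightarrow> (nat \<times> nat + nat \<Rightarrow> 'k::field mpoly fract) \<Rightarrow>
    nat + nat \<Rightarrow> 'k mpoly fract" where
  "psi_id r s \<beta> = (case \<beta> of
       Inl k \<Rightarrow> (\<Sum>(p, q)\<in>{(p, q). 1 \<le> p \<and> p < q \<and> q \<le> r}.
                   s (Inl (p, q)) * to_fract (psi_coeff r p q k))
     | Inr i \<Rightarrow> s (Inr i))"

text \<open>
  The ideal sheaf \<open>\<I>\<^sub>X\<close> of the double structure associated to \<open>\<mu>\<close>, by its stalks. The map
  \<open>\<I>\<^sub>C \<longrightarrow> \<I>\<^sub>C/\<I>\<^sub>C\<^sup>2 \<longrightarrow> \<L>\<close> sends a local section \<open>\<Sum>\<^sub>\<alpha> (F \<alpha> / G) gen \<alpha>\<close> of \<open>\<I>\<^sub>C\<close>, where \<open>F \<alpha> / G\<close> is a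
  section of \<open>\<O>(- gen_deg \<alpha>)\<close> on \<open>\<bbbP>\<^sup>n\<close>, to the image under \<open>\<mu> \<circ> (\<psi> \<oplus> id)\<close> of the vector of the
  \<open>j\<^sup>*(F \<alpha>) / j\<^sup>*G\<close>, because the class of the \<open>\<alpha>\<close>-th generator is \<open>\<psi>(e\<^sub>p \<and> e\<^sub>q)\<close> or a basis element.
  The stalk of \<open>\<I>\<^sub>X\<close> at a point of \<open>C\<close> is the kernel; it contains \<open>\<I>\<^sub>C\<^sup>2\<close> since \<open>j\<^sup>*\<close> kills \<open>\<I>\<^sub>C\<close>.
\<close>
definition double_structure :: "nat \<Rightarrow> nat \<Rightarrow>
    ((nat + nat \<Rightarrow> 'k::field mpoly fract) \<Rightarrow> 'k mpoly fract) \<Rightarrow>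
    (nat \<Rightarrow> 'k) \<Rightarrow> 'k mpoly fract set" where
  "double_structure n r \<mu> P =
     (if P \<in> rnc n r then
        {to_fract (\<Sum>\<alpha>\<in>gen_idx n r. F \<alpha> * gen r \<alpha>) / to_fract G | F G e.
           (\<forall>\<alpha>\<in>gen_idx n r. F \<alpha> \<in> forms n (e - gen_deg \<alpha>)) \<and>
           G \<in> forms n e \<and> eval_at P G \<noteq> 0 \<and>
           \<mu> (psi_id r (\<lambda>\<alpha>. if \<alpha> \<in> gen_idx n r
                 then to_fract (pullback r (F \<alpha>)) / to_fract (pullback r G) else 0)) = 0}
      else stalk n 0 P)"

text \<open>The graded ring \<open>R/I\<^sub>C = H\<^sup>0\<^sub>*(C, \<O>\<^sub>C)\<close> and its homogeneous pieces.\<close>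
abbreviation coord_ring :: "nat \<Rightarrow> nat \<Rightarrow> ('k::field mpoly set) ring" where
  "coord_ring n r \<equiv> poly_ring n Quot I_C n r"

definition coord_ring_deg :: "nat \<Rightarrow> nat \<Rightarrow> int \<Rightarrow> 'k::field mpoly set set" where
  "coord_ring_deg n r d = (\<lambda>F. I_C n r +>\<^bsub>poly_ring n\<^esub> F) ` forms n d"

text \<open>The map induced by \<open>j\<^sup>*\<close> on \<open>R/I\<^sub>C\<close>; all elements of a coset have the same image.\<close>
definition pullback_class :: "nat \<Rightarrow> 'k::field mpoly set \<Rightarrow> 'k mpoly" where
  "pullback_class r A = the_elem (pullback r ` A)"

text \<open>
  The degree \<open>i\<close> part of \<open>H\<^sup>0\<^sub>*(C, \<and>\<^sup>2\<O>\<^sub>C\<^sup>r(-1) \<oplus> \<O>\<^sub>C\<^sup>n\<^sup>-\<^sup>r(-1))\<close>, a free graded \<open>R/I\<^sub>C\<close>-module, and the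
  degree \<open>i\<close> part of the map to \<open>H\<^sup>0\<^sub>*(C, \<L>)\<close>. Note that \<open>j\<^sup>*\<O>\<^sub>C(i) = \<O>\<^bsub>\<bbbP>\<^sup>1\<^esub>(r i)\<close>.
\<close>
definition source_deg :: "nat \<Rightarrow> nat \<Rightarrow> int \<Rightarrow> (nat \<times> nat + nat \<Rightarrow> 'k::field mpoly set) set" where
  "source_deg n r i = (\<Pi>\<^sub>E \<alpha>\<in>gen_idx n r. coord_ring_deg n r (i - gen_deg \<alpha>))"

definition H0_map :: "nat \<Rightarrow> nat \<Rightarrow>
    ((nat + nat \<Rightarrow> 'k::field mpoly fract) \<Rightarrow> 'k mpoly fract) \<Rightarrow> int \<Rightarrow>
    (nat \<times> nat + nat \<Rightarrow> 'k mpoly set) \<Rightarrow> 'k mpoly fract" where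
  "H0_map n r \<mu> i c = twist (int r * i) (\<mu> \<circ> psi_id r)
     (\<lambda>\<alpha>. if \<alpha> \<in> gen_idx n r then to_fract (pullback_class r (c \<alpha>)) else 0)"

text \<open>
  \<open>N\<close> represents a homogeneous map \<open>\<nu>\<close> from the free graded module \<open>F\<^sub>1 = \<Oplus>\<^sub>k\<^sub><\<^sub>b (R/I\<^sub>C)(- d k)\<close>, and
  the image of \<open>\<nu>\<close> is the kernel of \<open>H0_map\<close> (in each degree).
\<close>
definition nu :: "nat \<Rightarrow> nat \<Rightarrow> nat \<Rightarrow> (nat \<times> nat + nat \<Rightarrow> nat \<Rightarrow> 'k::field mpoly set) \<Rightarrow>
    (nat \<Rightarrow> 'k mpoly set) \<Rightarrow> nat \<times> nat + nat \<Rightarrow> 'k mpoly set" where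
  "nu n r b N c = (\<lambda>\<alpha>\<in>gen_idx n r.
     \<Oplus>\<^bsub>coord_ring n r\<^esub>k\<in>{..<b}. N \<alpha> k \<otimes>\<^bsub>coord_ring n r\<^esub> c k)"

definition presents_kernel :: "nat \<Rightarrow> nat \<Rightarrow>
    ((nat + nat \<Rightarrow> 'k::field mpoly fract) \<Rightarrow> 'k mpoly fract) \<Rightarrow> nat \<Rightarrow> (nat \<Rightarrow> int) \<Rightarrow>
    (nat \<times> nat + nat \<Rightarrow> nat \<Rightarrow> 'k mpoly set) \<Rightarrow> bool" where
  "presents_kernel n r \<mu> b d N \<longleftrightarrow>
     (\<forall>\<alpha>\<in>gen_idx n r. \<forall>k<b. N \<alpha> k \<in> coord_ring_deg n r (d k - gen_deg \<alpha>)) \<and>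
     (\<forall>i. nu n r b N ` (\<Pi>\<^sub>E k\<in>{..<b}. coord_ring_deg n r (i - d k)) =
          {c \<in> source_deg n r i. H0_map n r \<mu> i c = 0})"

definition lifts :: "nat \<Rightarrow> nat \<Rightarrow> nat \<Rightarrow> (nat \<times> nat + nat \<Rightarrow> nat \<Rightarrow> 'k::field mpoly) \<Rightarrow>
    (nat \<times> nat + nat \<Rightarrow> nat \<Rightarrow> 'k mpoly set) \<Rightarrow> bool" where
  "lifts n r b M N \<longleftrightarrow> (\<forall>\<alpha>\<in>gen_idx n r. \<forall>k<b.
     (\<exists>e. M \<alpha> k \<in> forms n e) \<and> I_C n r +>\<^bsub>poly_ring n\<^esub> M \<alpha> k = N \<alpha> k)"

text \<open>The \<open>k\<close>-th entry of the row matrix \<open>[I\<^sub>C]M\<close> is \<open>\<Sum>\<^sub>\<alpha> gen \<alpha> M\<^sub>\<alpha>\<^sub>k\<close>.\<close>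
definition I_X :: "nat \<Rightarrow> nat \<Rightarrow> nat \<Rightarrow> (nat \<times> nat + nat \<Rightarrow> nat \<Rightarrow> 'k::field mpoly) \<Rightarrow>
    'k mpoly set" where
  "I_X n r b M = Idl\<^bsub>poly_ring n\<^esub> (ideal_prod (poly_ring n) (I_C n r) (I_C n r) \<union>
     {\<Sum>\<alpha>\<in>gen_idx n r. gen r \<alpha> * M \<alpha> k | k. k < b})"

end

theory Submission
  imports Defs
begin

text \<open>
  A morphism \<open>\<mu>\<close> of sums of line bundles on \<open>\<bbbP>\<^sup>1\<close> is multiplication by rational functions \<open>m\<^sub>\<beta>\<close>. For
  \<open>F = \<Sum>\<^sub>\<alpha> S \<alpha> gen \<alpha>\<close> in \<open>I\<^sub>C\<close> the class \<open>\<Sum>\<^sub>\<beta> m\<^sub>\<beta> \<psi>(j\<^sup>*S)\<^sub>\<beta>\<close> depends on \<open>F\<close> only: the components of \<open>\<psi>(j\<^sup>*S)\<close> are,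
  up to monomials, directional derivatives of \<open>F\<close> at the points of \<open>C\<close>. By the choice of \<open>N\<close>, a form \<open>F\<close> of \<open>I\<^sub>C\<close> lies
  in \<open>I\<^sub>X\<close> if and only if its class vanishes, which is the condition defining the stalks of \<open>\<I>\<^sub>X\<close> on \<open>C\<close>. Off \<open>C\<close> the
  square of some generator of \<open>I\<^sub>C\<close> is a unit. If \<open>x\<^sub>0\<^sup>k F \<in> I\<^sub>X\<close>, then \<open>F \<in> I\<^sub>C\<close>, because \<open>I\<^sub>C\<close> is the kernel of \<open>j\<^sup>*\<close>,
  and the class of \<open>F\<close> is killed by \<open>t\<^sup>r\<^sup>k\<close>, hence zero; so \<open>F \<in> I\<^sub>X\<close>.
\<close>

section \<open>Polynomials as finite sums of monomial terms\<close>

abbreviation lookup :: "('a \<Rightarrow>\<^sub>0 'b::zero) \<Rightarrow> 'a \<Rightarrow> 'b" where "lookup \<equiv> Poly_Mapping.lookup"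
abbreviation keys :: "('a \<Rightarrow>\<^sub>0 'b::zero) \<Rightarrow> 'a set" where "keys \<equiv> Poly_Mapping.keys"
abbreviation single :: "'a \<Rightarrow> 'b \<Rightarrow> 'a \<Rightarrow>\<^sub>0 'b::zero" where "single \<equiv> Poly_Mapping.single"

lemma poly_mapping_sum_singles: "(\<Sum>k\<in>keys F. single k (lookup F k)) = F"
proof (rule poly_mapping_eqI)
  fix k
  show "lookup (\<Sum>k\<in>keys F. single k (lookup F k)) k = lookup F k"
    by (auto simp: lookup_sum lookup_single when_def in_keys_iff)
qed

lemma poly_mapping_induct [case_names zero single add]:
  fixes F :: "'a \<Rightarrow>\<^sub>0 'b::comm_monoid_add"
  assumes "P 0" "\<And>k v. P (single k v)" "\<And>F G. P F \<Longrightarrow> P G \<Longrightarrow> P (F + G)"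
  shows "P F"
proof -
  have "finite A \<Longrightarrow> P (\<Sum>k\<in>A. single k (lookup F k))" for A
    by (induction A rule: finite_induct) (auto intro: assms)
  from this[of "keys F"] show ?thesis by (simp add: poly_mapping_sum_singles)
qed

subsection \<open>Evaluation\<close>

definition mono_eval :: "(nat \<Rightarrow> 'b::comm_semiring_1) \<Rightarrow> (nat \<Rightarrow>\<^sub>0 nat) \<Rightarrow> 'b" where
  "mono_eval \<sigma> m = (\<Prod>i\<in>keys m. \<sigma> i ^ lookup m i)"

lemma mono_eval_superset:
  assumes "finite A" "keys m \<subseteq> A"
  shows "mono_eval \<sigma> m = (\<Prod>i\<in>A. \<sigma> i ^ lookup m i)"
  unfolding mono_eval_def using assms
  by (intro prod.mono_neutral_left) (auto simp: in_keys_iff)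

lemma mono_eval_0 [simp]: "mono_eval \<sigma> 0 = 1"
  by (simp add: mono_eval_def)

lemma mono_eval_single [simp]: "mono_eval \<sigma> (single i k) = \<sigma> i ^ k"
  by (cases "k = 0") (simp_all add: mono_eval_def)

lemma mono_eval_add: "mono_eval \<sigma> (m + m') = mono_eval \<sigma> m * mono_eval \<sigma> m'"
proof -
  let ?A = "keys m \<union> keys m'"
  have "mono_eval \<sigma> (m + m') = (\<Prod>i\<in>?A. \<sigma> i ^ lookup (m + m') i)"
    using keys_add[of m m'] by (intro mono_eval_superset) auto
  then show ?thesis
    by (simp add: mono_eval_superset[of ?A] lookup_add power_add prod.distrib)
qed

lemma mpoly_eval_superset:
  assumes "finite A" "keys F \<subseteq> A" "c 0 = 0"
  shows "mpoly_eval c \<sigma> F = (\<Sum>m\<in>A. c (lookup F m) * mono_eval \<sigma> m)"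
  unfolding mpoly_eval_def mono_eval_def using assms
  by (intro sum.mono_neutral_left) (auto simp: in_keys_iff)

text \<open>Three coefficient maps occur: \<open>Const\<close> for \<open>pullback\<close>, the
  identity for \<open>eval_at\<close>, and the embedding as constant polynomials for
  \<open>deform\<close>.\<close>

locale coeff_hom =
  fixes c :: "'k::field \<Rightarrow> 'b::comm_semiring_1"
  assumes c_0: "c 0 = 0" and c_1: "c 1 = 1"
    and c_add: "c (x + y) = c x + c y" and c_mult: "c (x * y) = c x * c y"
begin

lemma eval_0 [simp]: "mpoly_eval c \<sigma> 0 = 0"
  by (simp add: mpoly_eval_def)

lemma eval_single: "mpoly_eval c \<sigma> (single m x) = c x * mono_eval \<sigma> m"
  by (simp add: mpoly_eval_superset[of "{m}"] c_0)

lemma eval_add: "mpoly_eval c \<sigma> (F + G) = mpoly_eval c \<sigma> F + mpoly_eval c \<sigma> G"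
proof -
  let ?A = "keys F \<union> keys G"
  have "mpoly_eval c \<sigma> (F + G) = (\<Sum>m\<in>?A. c (lookup (F + G) m) * mono_eval \<sigma> m)"
    using keys_add[of F G] by (intro mpoly_eval_superset) (auto simp: c_0)
  then show ?thesis
    by (simp add: mpoly_eval_superset[of ?A] c_0 lookup_add c_add distrib_right sum.distrib)
qed

text \<open>Both sides are additive in \<open>F\<close> and in \<open>G\<close>, so two nested
  inductions reduce the claim to a product of two monomials.\<close>

lemma eval_mult: "mpoly_eval c \<sigma> (F * G) = mpoly_eval c \<sigma> F * mpoly_eval c \<sigma> G"
proof (induction F rule: poly_mapping_induct)
  case (single k v)
  show ?case
    by (induction G rule: poly_mapping_induct)
      (simp_all add: mult_single eval_single eval_add c_mult mono_eval_add algebra_simps)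
qed (simp_all add: eval_add algebra_simps)

lemma eval_1 [simp]: "mpoly_eval c \<sigma> 1 = 1"
  unfolding single_one[symmetric] eval_single by (simp add: c_1)

lemma eval_Var [simp]: "mpoly_eval c \<sigma> (Var i) = \<sigma> i"
  by (simp add: Var_def eval_single c_1)

lemma eval_Const [simp]: "mpoly_eval c \<sigma> (Const x) = c x"
  by (simp add: Const_def eval_single)

lemma eval_power: "mpoly_eval c \<sigma> (F ^ k) = mpoly_eval c \<sigma> F ^ k"
  by (induction k) (simp_all add: eval_mult)

lemma eval_sum: "mpoly_eval c \<sigma> (sum F A) = (\<Sum>x\<in>A. mpoly_eval c \<sigma> (F x))"
  by (induction A rule: infinite_finite_induct) (simp_all add: eval_add)

end

lemma Const_0 [simp]: "Const 0 = 0" and Const_1 [simp]: "Const 1 = 1"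
  and Const_add: "Const (x + y) = Const x + Const y"
  and Const_mult: "Const (x * y) = Const x * Const y"
  by (simp_all add: Const_def single_add mult_single)

interpretation coeff_Const: coeff_hom Const
  by unfold_locales (simp_all add: Const_add Const_mult)

interpretation coeff_id: coeff_hom "\<lambda>c. c"
  by unfold_locales simp_all

lemma Var_neq_0 [simp]: "Var i \<noteq> 0"
proof
  assume "Var i = (0 :: 'a mpoly)"
  then have "lookup (Var i :: 'a mpoly) (single i 1) = 0" by simp
  then show False by (simp add: Var_def)
qed

lemma Var_power: "Var i ^ k = single (single i k) 1"
  by (induction k) (simp_all add: Var_def mult_single flip: single_add)

subsection \<open>Degrees\<close>

lemma mon_deg_superset:
  assumes "finite A" "keys m \<subseteq> A"
  shows "mon_deg m = (\<Sum>i\<in>A. lookup m i)"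
  unfolding mon_deg_def using assms
  by (intro sum.mono_neutral_left) (auto simp: in_keys_iff)

lemma mon_deg_0 [simp]: "mon_deg 0 = 0"
  by (simp add: mon_deg_def)

lemma mon_deg_single [simp]: "mon_deg (single i k) = k"
  by (simp add: mon_deg_superset[of "{i}"])

lemma mon_deg_add: "mon_deg (m + m') = mon_deg m + mon_deg m'"
proof -
  let ?A = "keys m \<union> keys m'"
  have "mon_deg (m + m') = (\<Sum>i\<in>?A. lookup (m + m') i)"
    using keys_add[of m m'] by (intro mon_deg_superset) auto
  then show ?thesis
    by (simp add: mon_deg_superset[of ?A] lookup_add sum.distrib)
qed

abbreviation polys :: "nat \<Rightarrow> 'k::field mpoly set" where
  "polys n \<equiv> carrier (poly_ring n)"

lemma polys_iff: "F \<in> polys n \<longleftrightarrow> (\<forall>m\<in>keys F. keys m \<subseteq> {..n})"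
  by (simp add: poly_ring_def)

lemma polys_0 [simp, intro]: "0 \<in> polys n" and polys_1 [simp, intro]: "1 \<in> polys n"
  by (simp_all add: polys_iff)

lemma polys_add [intro]: "F \<in> polys n \<Longrightarrow> G \<in> polys n \<Longrightarrow> F + G \<in> polys n"
  using keys_add[of F G] by (fastforce simp: polys_iff)

lemma polys_uminus [intro]: "F \<in> polys n \<Longrightarrow> - F \<in> polys n"
  by (simp add: polys_iff in_keys_iff)

lemma polys_mult [intro]: "F \<in> polys n \<Longrightarrow> G \<in> polys n \<Longrightarrow> F * G \<in> polys n"
proof -
  assume F: "F \<in> polys n" and G: "G \<in> polys n"
  show "F * G \<in> polys n"
    unfolding polys_iff
  proof
    fix m assume "m \<in> keys (F * G)"
    then obtain a b where "m = a + b" "a \<in> keys F" "b \<in> keys G"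
      using keys_mult[of F G] by blast
    then show "keys m \<subseteq> {..n}"
      using F G keys_add[of a b] by (fastforce simp: polys_iff)
  qed
qed

lemma polys_sum [intro]: "(\<And>x. x \<in> A \<Longrightarrow> F x \<in> polys n) \<Longrightarrow> sum F A \<in> polys n"
  by (induction A rule: infinite_finite_induct) auto

lemma polys_power [intro]: "F \<in> polys n \<Longrightarrow> F ^ k \<in> polys n"
  by (induction k) auto

lemma polys_Var [intro]: "i \<le> n \<Longrightarrow> Var i \<in> polys n"
  by (simp add: polys_iff Var_def)

lemma formsI:
  assumes "F \<in> polys n" "\<And>m. m \<in> keys F \<Longrightarrow> int (mon_deg m) = d"
  shows "F \<in> forms n d"
  using assms by (simp add: forms_def)

lemma forms_polys: "F \<in> forms n d \<Longrightarrow> F \<in> polys n"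
  by (simp add: forms_def)

lemma forms_0 [simp, intro]: "0 \<in> forms n d"
  by (simp add: forms_def)

lemma forms_1 [simp, intro]: "1 \<in> forms n 0"
  by (simp add: forms_def)

lemma forms_add [intro]: "F \<in> forms n d \<Longrightarrow> G \<in> forms n d \<Longrightarrow> F + G \<in> forms n d"
  using keys_add[of F G] polys_add[of F n G] unfolding forms_def by blast

lemma forms_uminus [intro]: "F \<in> forms n d \<Longrightarrow> - F \<in> forms n d"
  using polys_uminus[of F n] by (simp add: forms_def in_keys_iff)

lemma forms_diff [intro]: "F \<in> forms n d \<Longrightarrow> G \<in> forms n d \<Longrightarrow> F - G \<in> forms n d"
  using forms_add[of F n d "- G"] forms_uminus[of G n d] by simp

lemma forms_sum [intro]: "(\<And>x. x \<in> A \<Longrightarrow> F x \<in> forms n d) \<Longrightarrow> sum F A \<in> forms n d"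
  by (induction A rule: infinite_finite_induct) auto

lemma forms_mult:
  assumes "F \<in> forms n d" "G \<in> forms n e" "d + e = f"
  shows "F * G \<in> forms n f"
proof (rule formsI)
  show "F * G \<in> polys n"
    using assms by (auto dest: forms_polys)
  fix m assume "m \<in> keys (F * G)"
  then obtain a b where "m = a + b" "a \<in> keys F" "b \<in> keys G"
    using keys_mult[of F G] by blast
  with assms show "int (mon_deg m) = f"
    by (auto simp: forms_def mon_deg_add)
qed

lemma forms_power: "F \<in> forms n d \<Longrightarrow> F ^ k \<in> forms n (int k * d)"
  by (induction k) (auto simp: algebra_simps intro: forms_mult)

lemma forms_Var [intro]: "i \<le> n \<Longrightarrow> Var i \<in> forms n 1"
  by (simp add: polys_iff Var_def forms_def)

text \<open>Integer degrees, because shifted degrees such as \<open>e - gen_deg \<alpha>\<close> may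
  be negative; the component is then 0, in accordance with \<open>forms\<close>.\<close>

definition hcomp :: "int \<Rightarrow> 'k::field mpoly \<Rightarrow> 'k mpoly" where
  "hcomp e F = (if e < 0 then 0 else hom_comp (nat e) F)"

lemma lookup_hcomp: "lookup (hcomp e F) m = (if int (mon_deg m) = e then lookup F m else 0)"
proof -
  have "lookup (hom_comp d F) m = (if mon_deg m = d then lookup F m else 0)" for d
    by (auto simp: hom_comp_def lookup_sum lookup_single when_def in_keys_iff)
  then show ?thesis by (auto simp: hcomp_def)
qed

lemma hom_comp_hcomp: "hom_comp d F = hcomp (int d) F"
  by (simp add: hcomp_def)

lemma hcomp_add: "hcomp e (F + G) = hcomp e F + hcomp e G"
  by (rule poly_mapping_eqI) (simp add: lookup_hcomp lookup_add)

lemma hcomp_0 [simp]: "hcomp e 0 = 0"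
  by (rule poly_mapping_eqI) (simp add: lookup_hcomp)

lemma hcomp_sum: "hcomp e (sum F A) = (\<Sum>x\<in>A. hcomp e (F x))"
  by (induction A rule: infinite_finite_induct) (simp_all add: hcomp_add)

lemma hcomp_forms [intro]: "F \<in> polys n \<Longrightarrow> hcomp e F \<in> forms n e"
  by (auto simp: forms_def polys_iff in_keys_iff lookup_hcomp split: if_splits)

lemma hcomp_form: "F \<in> forms n d \<Longrightarrow> hcomp e F = (if e = d then F else 0)"
  by (rule poly_mapping_eqI) (auto simp: lookup_hcomp forms_def in_keys_iff)

lemma hcomp_mult:
  assumes G: "G \<in> forms n g" and F: "F \<in> polys n"
  shows "hcomp e (F * G) = hcomp (e - g) F * G"
proof -
  have 1: "hcomp e (single m x * G) = hcomp (e - g) (single m x) * G" for m x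
  proof -
    \<comment> \<open>The induction forgets that \<open>F\<close> lies in \<open>polys n\<close>, so
      a monomial may involve further variables; both factors are viewed in a larger polynomial
      ring.\<close>
    obtain N where N: "n \<le> N" "keys m \<subseteq> {..N}"
      using finite_nat_set_iff_bounded_le[of "keys m \<union> {n}"] by auto
    have s: "single m x \<in> forms N (int (mon_deg m))"
      using N by (simp add: forms_def polys_iff)
    have G': "G \<in> forms N g"
      using G N by (fastforce simp: forms_def polys_iff)
    show ?thesis
      using hcomp_form[OF forms_mult[OF s G' refl]] hcomp_form[OF s] by auto
  qed
  show ?thesis
    by (induction F rule: poly_mapping_induct) (auto simp: 1 hcomp_add distrib_right)
qed

lemma sum_hcomp:
  obtains N where "F = (\<Sum>e\<le>(N::nat). hcomp (int e) F)"
proof -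
  obtain N where N: "\<And>m. m \<in> keys F \<Longrightarrow> mon_deg m \<le> N"
    using finite_nat_set_iff_bounded_le[of "mon_deg ` keys F"] by auto
  have "F = (\<Sum>e\<le>N. hcomp (int e) F)"
  proof (rule poly_mapping_eqI)
    fix m
    show "lookup F m = lookup (\<Sum>e\<le>N. hcomp (int e) F) m"
      using N[of m] by (auto simp: lookup_sum lookup_hcomp in_keys_iff)
  qed
  then show ?thesis by (rule that)
qed

subsection \<open>The ideal of the rational normal curve\<close>

text \<open>Keeps \<open>Var 1\<close> and \<open>forms 1\<close> from being rewritten to \<open>Var (Suc 0)\<close> and \<open>forms (Suc 0)\<close>.\<close>
declare One_nat_def [simp del]

lemma poly_ring_simps [simp]:
  "mult (poly_ring n) = (*)" "add (poly_ring n) = (+)" "zero (poly_ring n) = 0" "one (poly_ring n) = 1"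
  by (simp_all add: poly_ring_def)

lemma poly_ring_cring: "cring (poly_ring n)"
proof (rule cringI)
  show "abelian_group (poly_ring n)"
    by (rule abelian_groupI) (auto simp: algebra_simps intro!: bexI[of _ "- x" for x])
  show "comm_monoid (poly_ring n)"
    by (rule comm_monoidI) (auto simp: algebra_simps)
qed (auto simp: algebra_simps)

text \<open>Closure under negation comes from multiplication by the constant -1.\<close>

lemma ideal_poly_ring_iff:
  "ideal I (poly_ring n) \<longleftrightarrow> I \<subseteq> polys n \<and> 0 \<in> I \<and> (\<forall>F\<in>I. \<forall>G\<in>I. F + G \<in> I) \<and>
     (\<forall>F\<in>I. \<forall>H\<in>polys n. H * F \<in> I)"
  (is "?l \<longleftrightarrow> ?r")
proof
  assume ?l
  then interpret ideal I "poly_ring n" .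
  show ?r
    using a_subset additive_subgroup.zero_closed[OF additive_subgroup_axioms]
      additive_subgroup.a_closed[OF additive_subgroup_axioms] I_l_closed by auto
next
  assume r: ?r
  interpret cring "poly_ring n" by (rule poly_ring_cring)
  have inv: "inv\<^bsub>add_monoid (poly_ring n)\<^esub> F = - F" if "F \<in> polys n" for F
    using that minus_equality[of "- F" F] by (auto simp: a_inv_def)
  show ?l
  proof (rule idealI)
    show "ring (poly_ring n)" by (rule ring_axioms)
    show "subgroup I (add_monoid (poly_ring n))"
    proof (rule subgroup.intro)
      fix F assume F: "F \<in> I"
      with r have "(- 1) * F \<in> I" by blast
      with F r show "inv\<^bsub>add_monoid (poly_ring n)\<^esub> F \<in> I"
        by (subst inv) auto
    qed (use r in auto)
  qed (use r in \<open>auto simp: mult.commute\<close>)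
qed

lemma polys_prod_list: "set xs \<subseteq> {..n} \<Longrightarrow> prod_list (map Var xs) \<in> polys n"
  by (induction xs) auto

lemma finite_gen_idx [simp]: "finite (gen_idx n r)"
proof -
  have "finite {(p, q). 1 \<le> p \<and> p < q \<and> q \<le> r}"
    by (rule finite_subset[of _ "{..r} \<times> {..r}"]) auto
  then show ?thesis by (simp add: gen_idx_def)
qed

lemma gen_forms:
  assumes "r \<le> n" "\<alpha> \<in> gen_idx n r"
  shows "gen r \<alpha> \<in> forms n (gen_deg \<alpha>)"
  using assms
  by (auto simp: gen_idx_def gen_def gen_deg_def minor_def intro!: forms_diff forms_mult[where d=1 and e=1] forms_Var)

lemma sum_if_eq:
  fixes f :: "'a \<Rightarrow> 'b::semiring_1"
  assumes "finite B" "x \<in> B"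
  shows "(\<Sum>y\<in>B. (if y = x then 1 else 0) * f y) = f x"
  using assms by (simp add: if_distrib[of "\<lambda>c. c * _"] cong: if_cong)

text \<open>The combinations of the generators form an ideal that contains every generator, and any
  ideal containing the generators contains all combinations.\<close>

lemma I_C_iff:
  fixes F :: "'k::field mpoly"
  assumes "r \<le> n"
  shows "F \<in> I_C n r \<longleftrightarrow>
    (\<exists>S. (\<forall>\<alpha>\<in>gen_idx n r. S \<alpha> \<in> polys n) \<and> F = (\<Sum>\<alpha>\<in>gen_idx n r. S \<alpha> * gen r \<alpha>))"
    (is "_ \<longleftrightarrow> ?P F")
proof -
  interpret cring "poly_ring n :: 'k mpoly ring" by (rule poly_ring_cring)
  let ?A = "gen_idx n r"
  have gens: "gen r ` ?A \<subseteq> (polys n :: 'k mpoly set)"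
    using forms_polys[OF gen_forms[OF assms]] by auto
  have "ideal (I_C n r :: 'k mpoly set) (poly_ring n)"
    unfolding I_C_def by (rule genideal_ideal[OF gens])
  then have I: "(0 :: 'k mpoly) \<in> I_C n r" "\<And>F G :: 'k mpoly. F \<in> I_C n r \<Longrightarrow> G \<in> I_C n r \<Longrightarrow> F + G \<in> I_C n r"
    "\<And>F H :: 'k mpoly. F \<in> I_C n r \<Longrightarrow> H \<in> polys n \<Longrightarrow> H * F \<in> I_C n r"
    by (auto simp: ideal_poly_ring_iff)
  have genI: "(gen r \<alpha> :: 'k mpoly) \<in> I_C n r" if "\<alpha> \<in> ?A" for \<alpha>
    using genideal_self[OF gens] that by (auto simp: I_C_def)
  have 1: "(\<Sum>\<alpha>\<in>B. S \<alpha> * gen r \<alpha>) \<in> I_C n r"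
    if "B \<subseteq> ?A" "\<forall>\<alpha>\<in>?A. S \<alpha> \<in> polys n" for B and S :: "_ \<Rightarrow> 'k mpoly"
    using that(1)
  proof (induction B rule: infinite_finite_induct)
    case (insert \<beta> B)
    then have "S \<beta> \<in> polys n" "(gen r \<beta> :: 'k mpoly) \<in> I_C n r"
      using that(2) genI by auto
    with insert I(2,3) show ?case by simp
  qed (use I in auto)
  have "ideal {F :: 'k mpoly. ?P F} (poly_ring n)"
    unfolding ideal_poly_ring_iff
  proof (intro conjI ballI)
    show "{F :: 'k mpoly. ?P F} \<subseteq> polys n"
      using gens by auto
    show "0 \<in> {F :: 'k mpoly. ?P F}"
      by (auto intro!: exI[of _ "\<lambda>_. 0"])
  next
    fix F G :: "'k mpoly" assume "F \<in> {F. ?P F}" "G \<in> {F. ?P F}"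
    then obtain S T where "\<forall>\<alpha>\<in>?A. S \<alpha> \<in> polys n" "F = (\<Sum>\<alpha>\<in>?A. S \<alpha> * gen r \<alpha>)"
      "\<forall>\<alpha>\<in>?A. T \<alpha> \<in> polys n" "G = (\<Sum>\<alpha>\<in>?A. T \<alpha> * gen r \<alpha>)" by auto
    then show "F + G \<in> {F. ?P F}"
      by (auto intro!: exI[of _ "\<lambda>\<alpha>. S \<alpha> + T \<alpha>"] simp: sum.distrib distrib_right)
  next
    fix F H :: "'k mpoly" assume "F \<in> {F. ?P F}" "H \<in> polys n"
    then obtain S where "\<forall>\<alpha>\<in>?A. S \<alpha> \<in> polys n" "F = (\<Sum>\<alpha>\<in>?A. S \<alpha> * gen r \<alpha>)" by auto
    with \<open>H \<in> polys n\<close> show "H * F \<in> {F. ?P F}"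
      by (auto intro!: exI[of _ "\<lambda>\<alpha>. H * S \<alpha>"] simp: sum_distrib_left mult.assoc)
  qed
  moreover have "gen r ` ?A \<subseteq> {F :: 'k mpoly. ?P F}"
  proof clarify
    fix \<alpha> assume "\<alpha> \<in> ?A"
    then show "?P (gen r \<alpha> :: 'k mpoly)"
      by (intro exI[of _ "\<lambda>\<beta>. if \<beta> = \<alpha> then 1 else 0"]) (auto simp: sum_if_eq)
  qed
  ultimately have "I_C n r \<subseteq> {F :: 'k mpoly. ?P F}"
    unfolding I_C_def by (rule genideal_minimal)
  then show ?thesis using 1[of ?A] by auto
qed

text \<open>The parameter \<open>k_type\<close> fixes the field \<open>'k\<close>, which
  \<open>n\<close> and \<open>r\<close> do not determine.\<close>

locale rational_normal_curve =
  fixes n r :: nat and k_type :: "'k::field itself"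
  assumes r_pos: "1 \<le> r" and r_le: "r \<le> n"
begin

abbreviation R :: "'k mpoly set" where "R \<equiv> polys n"
abbreviation I :: "'k mpoly set" where "I \<equiv> I_C n r"
abbreviation A :: "(nat \<times> nat + nat) set" where "A \<equiv> gen_idx n r"
abbreviation pb :: "'k mpoly \<Rightarrow> 'k mpoly" where "pb \<equiv> pullback r"

lemma gen_polys: "\<alpha> \<in> A \<Longrightarrow> gen r \<alpha> \<in> R"
  using forms_polys[OF gen_forms[OF r_le]] .

lemma ideal_I: "ideal I (poly_ring n)"
proof -
  interpret cring "poly_ring n" by (rule poly_ring_cring)
  show ?thesis
    unfolding I_C_def using gen_polys by (intro genideal_ideal) auto
qed

lemma I_polys: "F \<in> I \<Longrightarrow> F \<in> R"
  and I_0 [simp, intro]: "0 \<in> I"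
  and I_add [intro]: "F \<in> I \<Longrightarrow> G \<in> I \<Longrightarrow> F + G \<in> I"
  and I_mult [intro]: "F \<in> I \<Longrightarrow> H \<in> R \<Longrightarrow> H * F \<in> I"
  using ideal_I by (auto simp: ideal_poly_ring_iff)

lemma I_uminus [intro]: "F \<in> I \<Longrightarrow> - F \<in> I"
  using I_mult[of F "- 1"] by auto

lemma I_diff [intro]: "F \<in> I \<Longrightarrow> G \<in> I \<Longrightarrow> F - G \<in> I"
  using I_add[of F "- G"] by auto

lemma I_sum [intro]: "(\<And>x. x \<in> B \<Longrightarrow> F x \<in> I) \<Longrightarrow> sum F B \<in> I"
  by (induction B rule: infinite_finite_induct) auto

lemma gen_I: "\<alpha> \<in> A \<Longrightarrow> gen r \<alpha> \<in> I"
  unfolding I_C_iff[OF r_le]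
  by (intro exI[of _ "\<lambda>\<beta>. if \<beta> = \<alpha> then 1 else 0"]) (auto simp: sum_if_eq)

text \<open>The generators are homogeneous, so the degree \<open>e\<close> part of an arbitrary
  expansion of \<open>F\<close> is again an expansion of \<open>F\<close>.\<close>

lemma I_form_expansion:
  assumes "F \<in> I" "F \<in> forms n e"
  obtains S where "\<And>\<alpha>. \<alpha> \<in> A \<Longrightarrow> S \<alpha> \<in> forms n (e - gen_deg \<alpha>)"
    "F = (\<Sum>\<alpha>\<in>A. S \<alpha> * gen r \<alpha>)"
proof -
  obtain S where S: "\<And>\<alpha>. \<alpha> \<in> A \<Longrightarrow> S \<alpha> \<in> R" "F = (\<Sum>\<alpha>\<in>A. S \<alpha> * gen r \<alpha>)"
    using assms(1) I_C_iff[OF r_le] by blast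
  have "F = hcomp e F"
    using hcomp_form[OF assms(2), of e] by simp
  also have "\<dots> = (\<Sum>\<alpha>\<in>A. hcomp (e - gen_deg \<alpha>) (S \<alpha>) * gen r \<alpha>)"
    by (simp add: S(2) hcomp_sum hcomp_mult[OF gen_forms[OF r_le]] S(1))
  finally show ?thesis
    using S(1) by (intro that[of "\<lambda>\<alpha>. hcomp (e - gen_deg \<alpha>) (S \<alpha>)"]) auto
qed

lemma I_hcomp [intro]: "F \<in> I \<Longrightarrow> hcomp e F \<in> I"
proof -
  assume "F \<in> I"
  then obtain S where S: "\<And>\<alpha>. \<alpha> \<in> A \<Longrightarrow> S \<alpha> \<in> R" "F = (\<Sum>\<alpha>\<in>A. S \<alpha> * gen r \<alpha>)"
    using I_C_iff[OF r_le] by blast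
  then have "hcomp e F = (\<Sum>\<alpha>\<in>A. hcomp (e - gen_deg \<alpha>) (S \<alpha>) * gen r \<alpha>)"
    by (simp add: hcomp_sum hcomp_mult[OF gen_forms[OF r_le]])
  then show ?thesis
    using S(1) gen_I by (auto intro: forms_polys[OF hcomp_forms])
qed

section \<open>The pullback to the projective line\<close>

lemma pb_0 [simp]: "pb 0 = 0" and pb_1 [simp]: "pb 1 = 1"
  and pb_add: "pb (F + G) = pb F + pb G" and pb_mult: "pb (F * G) = pb F * pb G"
  and pb_power: "pb (F ^ k) = pb F ^ k" and pb_sum: "pb (sum f B) = (\<Sum>x\<in>B. pb (f x))"
  and pb_Var: "pb (Var i) = j_coord r i" and pb_Const: "pb (Const c) = Const c"
  by (simp_all add: pullback_def coeff_Const.eval_add coeff_Const.eval_mult coeff_Const.eval_power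
      coeff_Const.eval_sum)

lemma pb_diff: "pb (F - G) = pb F - pb G"
  using pb_add[of "F - G" G] by simp

text \<open>Both products in a minor pull back to the monomial with exponent
  \<open>2r + 1 - p - q\<close> at \<open>t\<close> and \<open>p + q - 1\<close> at
  \<open>u\<close>; the variables beyond \<open>x_r\<close> pull back to 0.\<close>

lemma pb_gen:
  assumes "\<alpha> \<in> A" shows "pb (gen r \<alpha>) = 0"
proof -
  have "j_coord r (p - 1) * j_coord r q = (j_coord r p * j_coord r (q - 1) :: 'k mpoly)"
    if "1 \<le> p" "p < q" "q \<le> r" for p q
  proof -
    have *: "tt ^ a * uu ^ b * (tt ^ c * uu ^ d) = (tt ^ (a + c) * uu ^ (b + d) :: 'k mpoly)" for a b c d
      by (simp add: power_add)
    from that have "r - (p - 1) + (r - q) = r - p + (r - (q - 1))" "p - 1 + q = p + (q - 1)"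
      by auto
    moreover from that have "p - 1 \<le> r" "q - 1 \<le> r" "p \<le> r" by auto
    ultimately show ?thesis
      using that by (simp only: j_coord_def * if_True)
  qed
  with assms show ?thesis
    by (auto simp: gen_idx_def gen_def minor_def pb_diff pb_mult pb_Var)
      (simp add: j_coord_def)
qed

lemma pb_I: "F \<in> I \<Longrightarrow> pb F = 0"
  unfolding I_C_iff[OF r_le] by (auto simp: pb_sum pb_mult pb_gen)

lemma pb_form:
  assumes "F \<in> forms n e"
  shows "pb F \<in> forms 1 (int r * e)"
proof -
  have j: "(j_coord r i :: 'k mpoly) \<in> forms 1 (int r)" for i
  proof (cases "i \<le> r")
    case True
    have "(tt :: 'k mpoly) \<in> forms 1 1" "(uu :: 'k mpoly) \<in> forms 1 1" by auto
    from forms_mult[OF forms_power[OF this(1)] forms_power[OF this(2)] refl, of "r - i" i] True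
    show ?thesis by (simp add: j_coord_def)
  qed (simp add: j_coord_def)
  have "(\<Prod>i\<in>B. j_coord r i ^ f i :: 'k mpoly) \<in> forms 1 (\<Sum>i\<in>B. int (f i) * int r)" for B and f :: "nat \<Rightarrow> nat"
    by (induction B rule: infinite_finite_induct) (auto intro!: forms_mult forms_power j)
  then have m: "(mono_eval (j_coord r) m :: 'k mpoly) \<in> forms 1 (int r * int (mon_deg m))" for m
    by (simp add: mono_eval_def mon_deg_def sum_distrib_left mult.commute)
  have c: "Const c \<in> forms 1 0" for c :: 'k
    by (simp add: Const_def forms_def polys_iff)
  show ?thesis
    unfolding pullback_def mpoly_eval_def mono_eval_def[symmetric]
  proof (rule forms_sum)
    fix m assume "m \<in> keys F"
    with assms have "int (mon_deg m) = e" by (simp add: forms_def)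
    with forms_mult[OF c m] show "Const (lookup F m) * mono_eval (j_coord r) m \<in> forms 1 (int r * e)"
      by simp
  qed
qed

section \<open>Normal forms of monomials modulo the ideal of the curve\<close>

lemma Var_exchange:
  assumes "k \<le> i" "i \<le> j" "j + k \<le> r"
  shows "Var i * Var j - Var (i - k) * Var (j + k) \<in> I"
  using assms
proof (induction k)
  case (Suc k)
  \<comment> \<open>This minor moves the two indices apart by one more unit, from
    \<open>i - k\<close> and \<open>j + k\<close>.\<close>
  have "Inl (i - k, Suc (j + k)) \<in> A"
    using Suc.prems by (auto simp: gen_idx_def)
  from gen_I[OF this] have "minor (i - k) (Suc (j + k)) \<in> I"
    by (simp add: gen_def)
  moreover have "Var i * Var j - Var (i - k) * Var (j + k) \<in> I"
    using Suc by simp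
  ultimately have "Var i * Var j - Var (i - k) * Var (j + k) - minor (i - k) (Suc (j + k)) \<in> I"
    by blast
  then show ?case by (simp add: minor_def One_nat_def)
qed simp

text \<open>The two indices are pushed apart as far as the range \<open>{0..r}\<close> allows: until
  the smaller one is 0 or the larger one is \<open>r\<close>.\<close>

lemma Var_collect:
  assumes "i \<le> r" "j \<le> r"
  shows "Var i * Var j - Var (min (i + j) r) * Var (i + j - min (i + j) r) \<in> I"
proof -
  have *: "Var i * Var j - Var (min (i + j) r) * Var (i + j - min (i + j) r) \<in> I"
    if "i \<le> j" "j \<le> r" for i j
  proof (cases "i + j \<le> r")
    case True
    with Var_exchange[of i i j] that show ?thesis
      by (simp add: min_absorb1 mult.commute add.commute)
  next
    case False
    then have "i - (r - j) = i + j - r" "j + (r - j) = r" using that by auto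
    with Var_exchange[of "r - j" i j] that False show ?thesis
      by (simp add: mult.commute)
  qed
  show ?thesis
    using *[of i j] *[of j i] assms by (cases "i \<le> j") (auto simp: mult.commute add.commute)
qed

text \<open>A greedy step towards the normal form: one variable absorbs as much of the weight as
  \<open>r\<close> permits, while the degree and the total weight are kept.\<close>

lemma mono_collect:
  assumes "set xs \<subseteq> {..r}" "xs \<noteq> []"
  obtains ys where "set ys \<subseteq> {..r}" "length xs = Suc (length ys)"
    "sum_list ys = sum_list xs - min (sum_list xs) r"
    "prod_list (map Var xs) - Var (min (sum_list xs) r) * prod_list (map Var ys) \<in> I"
proof -
  have "\<exists>ys. set ys \<subseteq> {..r} \<and> length xs = Suc (length ys) \<and>
      sum_list ys = sum_list xs - min (sum_list xs) r \<and>
      prod_list (map Var xs) - Var (min (sum_list xs) r) * prod_list (map Var ys) \<in> I"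
    using assms
  proof (induction xs)
    case (Cons i xs)
    show ?case
    proof (cases "xs = []")
      case True
      with Cons.prems show ?thesis by (auto intro!: exI[of _ "[]"] simp: min_absorb1)
    next
      case False
      \<comment> \<open>The tail is collected first, into a variable of index \<open>a\<close>; the
        head \<open>i\<close> is then combined with it, giving the index \<open>b\<close> and the
        remainder \<open>i + a - b\<close>.\<close>
      define a where "a = min (sum_list xs) r"
      define b where "b = min (i + a) r"
      obtain ys where ys: "set ys \<subseteq> {..r}" "length xs = Suc (length ys)"
        "sum_list ys = sum_list xs - a" "prod_list (map Var xs) - Var a * prod_list (map Var ys) \<in> I"
        using Cons False unfolding a_def by auto
      have i: "i \<le> r" using Cons.prems by auto
      have b: "b = min (i + sum_list xs) r" by (auto simp: b_def a_def)
      have "Var i * (prod_list (map Var xs) - Var a * prod_list (map Var ys))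
          + prod_list (map Var ys) * (Var i * Var a - Var b * Var (i + a - b)) \<in> I"
      proof (intro I_add I_mult ys(4))
        show "Var i * Var a - Var b * Var (i + a - b) \<in> I"
          using Var_collect[of i a] i by (simp add: a_def b_def)
        show "Var i \<in> R" using i r_le by auto
        show "prod_list (map Var ys) \<in> R" using ys(1) r_le by (intro polys_prod_list) auto
      qed
      also have "Var i * (prod_list (map Var xs) - Var a * prod_list (map Var ys))
          + prod_list (map Var ys) * (Var i * Var a - Var b * Var (i + a - b))
        = prod_list (map Var (i # xs)) - Var b * prod_list (map Var ((i + a - b) # ys))"
        by (simp add: algebra_simps)
      finally have "prod_list (map Var (i # xs)) - Var b * prod_list (map Var ((i + a - b) # ys)) \<in> I" .
      moreover have "i + a - b \<le> r" "sum_list ((i + a - b) # ys) = sum_list (i # xs) - b"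
        using i by (auto simp: ys(3) a_def b_def)
      moreover have "b = min (sum_list (i # xs)) r" by (simp add: b)
      ultimately show ?thesis
        using ys(1,2) by (intro exI[of _ "(i + a - b) # ys"]) auto
    qed
  qed simp
  then show ?thesis using that by blast
qed

text \<open>The normal form of the monomials in \<open>x\<^sub>0, \<dots>, x\<^sub>r\<close> of degree \<open>d\<close> and weight \<open>w = \<Sum>\<^sub>i i m\<^sub>i\<close>, modulo \<open>I\<^sub>C\<close>.\<close>
fun normal_mono :: "nat \<Rightarrow> nat \<Rightarrow> 'k mpoly" where
  "normal_mono 0 w = 1"
| "normal_mono (Suc d) w = Var (min w r) * normal_mono d (w - min w r)"

text \<open>Iterating the greedy step. Consequently monomials in \<open>x_0, ..., x_r\<close> of
  equal degree and weight are congruent modulo \<open>I\<close>.\<close>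

lemma mono_normal:
  "set xs \<subseteq> {..r} \<Longrightarrow> prod_list (map Var xs) - normal_mono (length xs) (sum_list xs) \<in> I"
proof (induction "length xs" arbitrary: xs)
  case (Suc d)
  then have "xs \<noteq> []" by auto
  from mono_collect[OF Suc.prems this] obtain ys where ys: "set ys \<subseteq> {..r}" "length xs = Suc (length ys)"
    "sum_list ys = sum_list xs - min (sum_list xs) r"
    "prod_list (map Var xs) - Var (min (sum_list xs) r) * prod_list (map Var ys) \<in> I"
    by metis
  let ?v = "Var (min (sum_list xs) r)"
  have "d = length ys" using Suc.hyps(2) ys(2) by simp
  from Suc.hyps(1)[OF this ys(1)] have "(prod_list (map Var xs) - ?v * prod_list (map Var ys))
      + ?v * (prod_list (map Var ys) - normal_mono (length ys) (sum_list ys)) \<in> I"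
    using ys(4) r_le by (intro I_add I_mult) auto
  then show ?case by (simp add: ys(2,3) algebra_simps)
qed simp

text \<open>The list form makes degree and weight the length and the sum of the list; the condition
  on \<open>set xs\<close> keeps track of the variables involved.\<close>

lemma single_as_product: "\<exists>xs. set xs = keys m \<and> single m 1 = (prod_list (map Var xs) :: 'k mpoly)"
proof (induction m rule: poly_mapping_induct)
  case zero
  show ?case by (intro exI[of _ "[]"]) simp
next
  case (single i k)
  show ?case by (intro exI[of _ "replicate k i"]) (auto simp flip: Var_power)
next
  case (add m m')
  then obtain xs ys where xs: "set xs = keys m" "single m 1 = (prod_list (map Var xs) :: 'k mpoly)"
    and ys: "set ys = keys m'" "single m' 1 = (prod_list (map Var ys) :: 'k mpoly)" by auto
  have "set (xs @ ys) = keys (m + m')"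
    by (auto simp: xs ys in_keys_iff lookup_add)
  moreover have "single (m + m') 1 = (prod_list (map Var (xs @ ys)) :: 'k mpoly)"
    by (simp flip: xs ys add: mult_single)
  ultimately show ?case by blast
qed

text \<open>A \<open>K\<close>-linear section, modulo \<open>I\<^sub>C\<close>, of \<open>j\<^sup>*\<close> onto its image: \<open>t\<^sup>a u\<^sup>w\<close> determines the degree \<open>(a + w) / r\<close>.\<close>
definition splitting :: "'k mpoly \<Rightarrow> 'k mpoly" where
  "splitting H = (\<Sum>m\<in>keys H. Const (lookup H m) *
     normal_mono ((lookup m 0 + lookup m 1) div r) (lookup m 1))"

lemma splitting_add: "splitting (F + G) = splitting F + splitting G"
proof -
  let ?f = "\<lambda>m. normal_mono ((lookup m 0 + lookup m 1) div r) (lookup m 1)"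
  have *: "splitting H = (\<Sum>m\<in>keys F \<union> keys G. Const (lookup H m) * ?f m)"
    if "keys H \<subseteq> keys F \<union> keys G" for H
    unfolding splitting_def using that by (intro sum.mono_neutral_left) (auto simp: in_keys_iff)
  show ?thesis
    by (simp add: * keys_add lookup_add Const_add distrib_right sum.distrib)
qed

lemma splitting_0 [simp]: "splitting 0 = 0"
  by (simp add: splitting_def)

lemma splitting_sum: "splitting (sum F B) = (\<Sum>x\<in>B. splitting (F x))"
  by (induction B rule: infinite_finite_induct) (simp_all add: splitting_add)

text \<open>The image depends on the degree and the weight alone. The inequality is carried through
  the induction because it makes the truncated subtraction in the exponent of \<open>t\<close>
  exact.\<close>

lemma pb_mono:
  "set xs \<subseteq> {..r} \<Longrightarrow> sum_list xs \<le> r * length xs \<and> pb (prod_list (map Var xs)) =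
     single (single 0 (r * length xs - sum_list xs) + single 1 (sum_list xs)) 1"
proof (induction xs)
  case (Cons i xs)
  then have "r * length (i # xs) - sum_list (i # xs) = r - i + (r * length xs - sum_list xs)"
    by (simp add: algebra_simps)
  moreover have "pb (prod_list (map Var (i # xs))) =
      single (single 0 (r - i) + single 1 i) 1 *
      single (single 0 (r * length xs - sum_list xs) + single 1 (sum_list xs)) 1"
    using Cons by (simp add: pb_mult pb_Var j_coord_def Var_power mult_single)
  then have "pb (prod_list (map Var (i # xs))) =
      single (single 0 (r - i + (r * length xs - sum_list xs)) + single 1 (i + sum_list xs)) 1"
    by (simp only: mult_single single_add mult_1_left ac_simps)
  ultimately show ?case using Cons by simp
qed simp

lemma splitting_pb_single:
  assumes "keys m \<subseteq> {..n}"
  shows "single m c - splitting (pb (single m c)) \<in> I"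
proof -
  obtain xs where xs: "set xs = keys m" "single m 1 = (prod_list (map Var xs) :: 'k mpoly)"
    using single_as_product by blast
  have m: "single m c = Const c * prod_list (map Var xs)"
    by (simp flip: xs add: Const_def mult_single)
  have c: "Const c \<in> R" by (simp add: Const_def polys_iff)
  show ?thesis
  proof (cases "set xs \<subseteq> {..r}")
    case True
    let ?w = "single 0 (r * length xs - sum_list xs) + single 1 (sum_list xs) :: nat \<Rightarrow>\<^sub>0 nat"
    have w: "lookup ?w 0 + lookup ?w 1 = r * length xs" "lookup ?w 1 = sum_list xs"
      using pb_mono[OF True] by (simp_all add: lookup_add lookup_single)
    have "pb (single m c) = single ?w c"
      using pb_mono[OF True] by (simp add: m pb_mult pb_Const) (simp add: Const_def mult_single)
    \<comment> \<open>The exponents of \<open>?w\<close> add up to \<open>r * length xs\<close>, so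
      division by the positive number \<open>r\<close> recovers the degree.\<close>
    then have "splitting (pb (single m c)) = Const c * normal_mono (length xs) (sum_list xs)"
      using r_pos w by (simp add: splitting_def)
    then show ?thesis
      using I_mult[OF mono_normal[OF True] c] by (simp add: m algebra_simps)
  next
    \<comment> \<open>A variable \<open>x_i\<close> with \<open>i > r\<close> divides the monomial.
      It is a generator, so the monomial lies in \<open>I\<close> and its pullback is 0.\<close>
    case False
    then obtain i where i: "i \<in> set xs" "r < i" by (auto simp: subset_iff not_le)
    then have eq: "prod_list (map Var xs) = Var i * prod_list (map Var (remove1 i xs) :: 'k mpoly list)"
      by (induction xs) auto
    have "i \<le> n" using i xs assms by auto
    with i have "Inr (i - r) \<in> A" by (auto simp: gen_idx_def)
    from gen_I[OF this] i have "Var i \<in> I" by (simp add: gen_def)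
    moreover have "prod_list (map Var (remove1 i xs)) \<in> R"
      using set_remove1_subset[of i xs] xs assms by (intro polys_prod_list) auto
    ultimately have "single m c \<in> I"
      unfolding m eq using c by (metis I_mult mult.commute)
    then show ?thesis by (simp add: pb_I)
  qed
qed

text \<open>By additivity \<open>F\<close> is congruent to \<open>splitting (pb F)\<close> modulo
  \<open>I\<close>, and \<open>splitting 0 = 0\<close>.\<close>

lemma I_iff_pb: "F \<in> R \<Longrightarrow> F \<in> I \<longleftrightarrow> pb F = 0"
proof
  assume F: "F \<in> R" "pb F = 0"
  have "(\<Sum>m\<in>keys F. single m (lookup F m) - splitting (pb (single m (lookup F m)))) \<in> I"
    using F by (intro I_sum splitting_pb_single) (auto simp: polys_iff)
  also have "(\<Sum>m\<in>keys F. single m (lookup F m) - splitting (pb (single m (lookup F m)))) =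
      (\<Sum>m\<in>keys F. single m (lookup F m)) - splitting (pb (\<Sum>m\<in>keys F. single m (lookup F m)))"
    by (simp add: sum_subtractf pb_sum splitting_sum)
  also have "\<dots> = F"
    by (simp add: poly_mapping_sum_singles F)
  finally show "F \<in> I" .
qed (rule pb_I)

end

subsection \<open>Stalks\<close>

lemma to_fract_power [simp]: "to_fract (x ^ k) = to_fract x ^ k"
  by (induction k) simp_all

lemma eval_at_Var: "eval_at P (Var i) = P i"
  and eval_at_1 [simp]: "eval_at P 1 = 1"
  and eval_at_add: "eval_at P (F + G) = eval_at P F + eval_at P G"
  and eval_at_mult: "eval_at P (F * G) = eval_at P F * eval_at P G"
  and eval_at_power: "eval_at P (F ^ k) = eval_at P F ^ k"
  and eval_at_0 [simp]: "eval_at P 0 = 0"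
  by (simp_all add: eval_at_def coeff_id.eval_add coeff_id.eval_mult coeff_id.eval_power)

lemma eval_at_diff: "eval_at P (F - G) = eval_at P F - eval_at P G"
  using eval_at_add[of P "F - G" G] by simp

lemma stalkI:
  assumes "F \<in> forms n (e + d)" "G \<in> forms n e" "eval_at P G \<noteq> 0"
  shows "to_fract F / to_fract G \<in> stalk n d P"
  unfolding stalk_def using assms by blast

lemma stalkE:
  assumes "s \<in> stalk n d P"
  obtains F G e where "s = to_fract F / to_fract G" "F \<in> forms n (e + d)" "G \<in> forms n e"
    "eval_at P G \<noteq> 0" "G \<noteq> 0"
  using assms unfolding stalk_def by (smt (verit) eval_at_0 mem_Collect_eq)

lemma stalk_form: "F \<in> forms n d \<Longrightarrow> to_fract F \<in> stalk n d P"
  using stalkI[of F n 0 d 1 P] by simp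

lemma stalk_inverse: "G \<in> forms n e \<Longrightarrow> eval_at P G \<noteq> 0 \<Longrightarrow> 1 / to_fract G \<in> stalk n (- e) P"
  using stalkI[of 1 n e "- e" G P] by simp

lemma stalk_mult:
  assumes "s \<in> stalk n a P" "s' \<in> stalk n b P" "a + b = c"
  shows "s * s' \<in> stalk n c P"
proof -
  from assms obtain F G e F' G' e' where
    F: "s = to_fract F / to_fract G" "F \<in> forms n (e + a)" "G \<in> forms n e" "eval_at P G \<noteq> 0"
    and F': "s' = to_fract F' / to_fract G'" "F' \<in> forms n (e' + b)" "G' \<in> forms n e'"
      "eval_at P G' \<noteq> 0"
    by (elim stalkE)
  have "to_fract (F * F') / to_fract (G * G') \<in> stalk n c P"
    using F F' assms(3)
    by (intro stalkI[where e = "e + e'"]) (auto intro!: forms_mult simp: eval_at_mult)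
  then show ?thesis by (simp add: F F')
qed

lemma stalk_0 [simp, intro]: "0 \<in> stalk n d P"
  using stalk_form[of 0] by simp

lemma stalk_add:
  assumes "s \<in> stalk n d P" "s' \<in> stalk n d P"
  shows "s + s' \<in> stalk n d P"
proof -
  from assms obtain F G e F' G' e' where
    F: "s = to_fract F / to_fract G" "F \<in> forms n (e + d)" "G \<in> forms n e" "eval_at P G \<noteq> 0" "G \<noteq> 0"
    and F': "s' = to_fract F' / to_fract G'" "F' \<in> forms n (e' + d)" "G' \<in> forms n e'"
      "eval_at P G' \<noteq> 0" "G' \<noteq> 0"
    by (elim stalkE)
  have "to_fract (F * G' + F' * G) / to_fract (G * G') \<in> stalk n d P"
    using F F'
    by (intro stalkI[where e = "e + e'"])
      (auto intro!: forms_add forms_mult[OF F(2) F'(3)] forms_mult[OF F'(2) F(3)]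
        forms_mult[OF F(3) F'(3)] simp: eval_at_mult)
  then show ?thesis using F(5) F'(5) by (simp add: F F' field_simps)
qed

lemma stalk_sum: "(\<And>x. x \<in> B \<Longrightarrow> s x \<in> stalk n d P) \<Longrightarrow> sum s B \<in> stalk n d P"
  by (induction B rule: infinite_finite_induct) (auto intro: stalk_add)

lemma stalk_Var_powi:
  assumes "i \<le> n" "P i \<noteq> 0"
  shows "to_fract (Var i) powi k \<in> stalk n k P"
proof (cases k rule: int_cases2)
  case (nonneg m)
  with forms_power[OF forms_Var[OF assms(1)], of m] show ?thesis
    by (auto dest: stalk_form)
next
  case (nonpos m)
  with forms_power[OF forms_Var[OF assms(1)], of m] assms(2) show ?thesis
    by (auto dest!: stalk_inverse simp: eval_at_power eval_at_Var power_int_minus divide_inverse)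
qed

text \<open>
  The coefficients are read off from the generators \<open>t\<^sup>d\<close> of the summands over \<open>t \<noteq> 0\<close>;
  the chart \<open>u \<noteq> 0\<close> gives the same ones because both generators live in the stalk at \<open>(1:1)\<close>.
\<close>
lemma sheaf_hom_linear:
  fixes \<phi> :: "('i \<Rightarrow> 'k::field mpoly fract) \<Rightarrow> 'k mpoly fract"
  assumes "finite B" and hom: "sheaf_hom B d b \<phi>"
  obtains m where "\<And>q s. q \<in> points 1 \<Longrightarrow> s \<in> sum_stalk B d q \<Longrightarrow> \<phi> s = (\<Sum>\<beta>\<in>B. m \<beta> * s \<beta>)"
proof -
  let ?e = "\<lambda>\<beta> c. (\<lambda>\<gamma>. if \<gamma> = \<beta> then c else 0) :: 'i \<Rightarrow> 'k mpoly fract"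
  have add: "\<phi> (\<lambda>\<alpha>. s \<alpha> + s' \<alpha>) = \<phi> s + \<phi> s'"
    if "q \<in> points 1" "s \<in> sum_stalk B d q" "s' \<in> sum_stalk B d q" for q s s'
    using hom that unfolding sheaf_hom_def by blast
  have scale: "\<phi> (\<lambda>\<alpha>. c * s \<alpha>) = c * \<phi> s"
    if "q \<in> points 1" "s \<in> sum_stalk B d q" "c \<in> stalk 1 0 q" for q s c
    using hom that unfolding sheaf_hom_def by blast
  have e: "?e \<beta> c \<in> sum_stalk B d q" if "\<beta> \<in> B" "c \<in> stalk 1 (d \<beta>) q" for \<beta> c q
    using that by (auto simp: sum_stalk_def)
  have chart: "\<phi> (?e \<beta> c) = \<phi> (?e \<beta> (to_fract (Var i) powi d \<beta>)) * (c * to_fract (Var i) powi (- d \<beta>))"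
    if "\<beta> \<in> B" "q \<in> points 1" "i \<le> 1" "q i \<noteq> 0" "c \<in> stalk 1 (d \<beta>) q" for \<beta> c q i
  proof -
    let ?w = "to_fract (Var i) powi d \<beta>" and ?w' = "to_fract (Var i) powi (- d \<beta>)"
    have w: "?w \<in> stalk 1 (d \<beta>) q" "c * ?w' \<in> stalk 1 0 q"
      using that by (auto intro!: stalk_Var_powi stalk_mult[OF that(5)])
    \<comment> \<open>Near \<open>q\<close> the section \<open>c\<close> is the function
      \<open>c * ?w'\<close> times the local generator \<open>?w\<close>.\<close>
    have "(\<lambda>\<gamma>. (c * ?w') * ?e \<beta> ?w \<gamma>) = ?e \<beta> c"
      by (auto simp: power_int_minus)
    then show ?thesis
      using scale[OF that(2) e[OF that(1) w(1)] w(2)] by (simp add: mult.commute)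
  qed
  define m where "m \<beta> = \<phi> (?e \<beta> (to_fract tt powi d \<beta>)) * to_fract tt powi (- d \<beta>)" for \<beta>
  let ?q = "\<lambda>i. if i \<le> 1 then 1 else 0 :: 'k"
  have q: "?q \<in> points 1" by (auto simp: points_def)
  have single: "\<phi> (?e \<beta> c) = m \<beta> * c" if "\<beta> \<in> B" "q \<in> points 1" "c \<in> stalk 1 (d \<beta>) q" for \<beta> c q
  proof (cases "q 0 = 0")
    case False
    then show ?thesis
      using chart[OF that(1,2), of 0 c] that(3) by (simp add: m_def ac_simps)
  next
    case True
    then have 1: "q 1 \<noteq> 0" using that(2) by (auto simp: points_def le_Suc_eq One_nat_def)
    have "\<phi> (?e \<beta> (to_fract uu powi d \<beta>)) = m \<beta> * to_fract uu powi d \<beta>"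
      using chart[OF that(1) q, of 0 "to_fract uu powi d \<beta>"] by (simp add: stalk_Var_powi m_def ac_simps)
    then show ?thesis
      using chart[OF that(1,2) _ 1 that(3)] by (simp add: power_int_minus)
  qed
  show ?thesis
  proof (rule that)
    fix q and s :: "'i \<Rightarrow> 'k mpoly fract" assume q: "q \<in> points 1" and s: "s \<in> sum_stalk B d q"
    have "\<phi> (\<lambda>\<beta>. if \<beta> \<in> D then s \<beta> else 0) = (\<Sum>\<beta>\<in>D. m \<beta> * s \<beta>)" if "D \<subseteq> B" for D
      using finite_subset[OF that assms(1)] that
    proof (induction D rule: finite_induct)
      case empty
      show ?case
        using scale[OF q s stalk_0] by simp
    next
      case (insert \<beta> D)
      have "(\<lambda>\<gamma>. if \<gamma> \<in> insert \<beta> D then s \<gamma> else 0) =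
          (\<lambda>\<gamma>. ?e \<beta> (s \<beta>) \<gamma> + (if \<gamma> \<in> D then s \<gamma> else 0))"
        using insert by auto
      moreover have "(\<lambda>\<gamma>. if \<gamma> \<in> D then s \<gamma> else 0) \<in> sum_stalk B d q" "s \<beta> \<in> stalk 1 (d \<beta>) q"
        using s insert by (auto simp: sum_stalk_def)
      ultimately show ?case
        using add[OF q e] single[OF _ q] insert by simp
    qed
    from this[of B] have "\<phi> (\<lambda>\<beta>. if \<beta> \<in> B then s \<beta> else 0) = (\<Sum>\<beta>\<in>B. m \<beta> * s \<beta>)" by simp
    moreover have "(\<lambda>\<beta>. if \<beta> \<in> B then s \<beta> else 0) = s"
      using s by (auto simp: sum_stalk_def)
    ultimately show "\<phi> s = (\<Sum>\<beta>\<in>B. m \<beta> * s \<beta>)" by simp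
  qed
qed

section \<open>Points of the rational normal curve\<close>

lemma eval_at_scale:
  assumes "F \<in> forms n e" "\<And>i. P i = c * Q i"
  shows "eval_at P F = c ^ nat e * eval_at Q F"
proof -
  have "lookup F m * mono_eval P m = c ^ nat e * (lookup F m * mono_eval Q m)" if "m \<in> keys F" for m
  proof -
    \<comment> \<open>A form of negative degree has no monomials, so \<open>nat e\<close> loses
      nothing here.\<close>
    have "mon_deg m = nat e" using assms(1) that by (auto simp: forms_def)
    then have "mono_eval P m = c ^ nat e * mono_eval Q m"
      by (simp add: mono_eval_def assms(2) power_mult_distrib prod.distrib mon_deg_def flip: power_sum)
    then show ?thesis by simp
  qed
  then show ?thesis
    unfolding eval_at_def mpoly_eval_def mono_eval_def[symmetric] sum_distrib_left
    by (rule sum.cong[OF refl])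
qed

context rational_normal_curve
begin

lemma eval_at_j: "eval_at q (j_coord r i) = (if i \<le> r then q 0 ^ (r - i) * q 1 ^ i else 0)"
  by (simp add: j_coord_def eval_at_mult eval_at_power eval_at_Var)

lemma eval_at_pb: "eval_at q (pb F) = eval_at (\<lambda>i. eval_at q (j_coord r i)) F"
proof (induction F rule: poly_mapping_induct)
  case (single m c)
  have "eval_at q (\<Prod>i\<in>B. f i) = (\<Prod>i\<in>B. eval_at q (f i))" for B and f :: "nat \<Rightarrow> 'k mpoly"
    by (induction B rule: infinite_finite_induct) (simp_all add: eval_at_mult)
  then have "eval_at q (mono_eval (j_coord r) m) = mono_eval (\<lambda>i. eval_at q (j_coord r i)) m"
    by (simp add: mono_eval_def eval_at_power)
  moreover have "eval_at q (Const c) = c"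
    by (simp add: eval_at_def)
  ultimately show ?case
    by (simp add: pullback_def coeff_Const.eval_single eval_at_mult)
      (simp add: eval_at_def coeff_id.eval_single)
qed (simp_all add: pb_add eval_at_add)

text \<open>The point \<open>q\<close> over \<open>P\<close> serves all denominators at once: the
  coordinates of \<open>P\<close> and of \<open>j(q)\<close> differ by a scalar, which changes the
  value of a form by a power of it.\<close>

lemma rnc_denominator:
  assumes P: "P \<in> rnc n r"
  obtains q where "q \<in> points 1"
    "\<And>G e. G \<in> forms n e \<Longrightarrow> eval_at P G \<noteq> 0 \<Longrightarrow> eval_at q (pb G) \<noteq> 0"
proof -
  from P obtain q c where q: "q \<in> points 1" "\<And>i. P i = c * eval_at q (j_coord r i)"
    unfolding rnc_def by blast
  have "eval_at q (pb G) \<noteq> 0" if "G \<in> forms n e" "eval_at P G \<noteq> 0" for G e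
    using that eval_at_scale[of G n e P c "\<lambda>i. eval_at q (j_coord r i)"] q(2) by (auto simp: eval_at_pb)
  with q(1) show ?thesis by (rule that)
qed

text \<open>The generators cut out the curve as a set. The points with nonzero \<open>x_0\<close>
  are the images of the chart where \<open>t\<close> is nonzero; the remaining one is the image of
  (0:1).\<close>

lemma zeros_in_rnc:
  assumes P: "P \<in> points n" and zero: "\<And>\<alpha>. \<alpha> \<in> A \<Longrightarrow> eval_at P (gen r \<alpha>) = 0"
  shows "P \<in> rnc n r"
proof -
  have minor: "P (p - 1) * P q = P p * P (q - 1)" if "1 \<le> p" "p < q" "q \<le> r" for p q
  proof -
    have "Inl (p, q) \<in> A" using that by (auto simp: gen_idx_def)
    from zero[OF this] have "eval_at P (minor p q) = 0" by (simp add: gen_def)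
    then show ?thesis
      by (simp add: minor_def eval_at_diff eval_at_mult eval_at_Var)
  qed
  have lin: "P i = 0" if "i > r" for i
  proof (cases "i \<le> n")
    case True
    with that have "Inr (i - r) \<in> A" by (auto simp: gen_idx_def)
    from zero[OF this] that show ?thesis by (simp add: gen_def eval_at_Var)
  qed (use P in \<open>auto simp: points_def\<close>)
  have "\<exists>q\<in>points 1. \<exists>c. c \<noteq> 0 \<and> (\<forall>i. P i = c * eval_at q (j_coord r i))"
  proof (cases "P 0 = 0")
    case False
    \<comment> \<open>The relation \<open>x_i / x_0 = (x_1 / x_0)^i\<close> without denominators; it
      comes from the minors with \<open>p = 1\<close>.\<close>
    have *: "P i * P 0 ^ i = P 0 * P 1 ^ i" if "i \<le> r" for i
      using that
    proof (induction i)
      case (Suc i)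
      have 1: "P 0 * P (Suc i) = P 1 * P i"
        using minor[of 1 "Suc i"] Suc.prems by (cases "i = 0") (auto simp: One_nat_def)
      have "P (Suc i) * P 0 ^ Suc i = P 0 * P (Suc i) * P 0 ^ i" by (simp add: ac_simps)
      also have "\<dots> = P 1 * (P i * P 0 ^ i)" unfolding 1 by (simp add: ac_simps)
      also have "P i * P 0 ^ i = P 0 * P 1 ^ i" using Suc by simp
      finally show ?case by (simp add: ac_simps)
    qed simp
    \<comment> \<open>The preimage of \<open>P\<close> is \<open>(P 0 : P 1)\<close>; the scalar
      \<open>P 0 / P 0 ^ r\<close> turns the first coordinate \<open>P 0 ^ r\<close> of its image
      into \<open>P 0\<close>.\<close>
    let ?q = "\<lambda>i. if i \<le> 1 then P i else 0"
    have le: "P i = P 0 / P 0 ^ r * (P 0 ^ (r - i) * P 1 ^ i)" if "i \<le> r" for i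
    proof -
      have "P 0 ^ r = P 0 ^ (r - i) * P 0 ^ i" using that by (simp flip: power_add)
      with *[OF that] False show ?thesis by (simp add: field_simps)
    qed
    have "P i = P 0 / P 0 ^ r * eval_at ?q (j_coord r i)" for i
    proof (cases "i \<le> r")
      case True
      then show ?thesis by (subst le[OF True]) (simp add: eval_at_j)
    qed (simp add: lin eval_at_j)
    moreover have "?q \<in> points 1"
      using False by (auto simp: points_def)
    moreover have "P 0 / P 0 ^ r \<noteq> 0"
      using False by simp
    ultimately show ?thesis by blast
  next
    case True
    \<comment> \<open>The minor of two adjacent columns gives
      \<open>x_(i+1)^2 = x_i x_(i+2)\<close>, so vanishing propagates up to the index
      \<open>r - 1\<close>.\<close>
    have *: "P i = 0" if "i < r" for i
      using that
    proof (induction i)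
      case (Suc i)
      then show ?case using minor[of "Suc i" "Suc (Suc i)"] by auto
    qed (use True in simp)
    then have i: "P i = 0" if "i \<noteq> r" for i
      using lin[of i] that by (cases i r rule: linorder_cases) auto
    moreover obtain i where "P i \<noteq> 0"
      using P by (auto simp: points_def)
    ultimately have "P r \<noteq> 0" by metis
    with i show ?thesis
      by (intro bexI[of _ "\<lambda>i. if i = 1 then 1 else 0"] exI[of _ "P r"])
        (auto simp: eval_at_j points_def power_0_left)
  qed
  with P show ?thesis by (simp add: rnc_def)
qed

subsection \<open>The conormal map\<close>

definition pb_vec :: "(nat \<times> nat + nat \<Rightarrow> 'k mpoly) \<Rightarrow> nat \<times> nat + nat \<Rightarrow> 'k mpoly fract" where
  "pb_vec S = (\<lambda>\<alpha>. if \<alpha> \<in> A then to_fract (pb (S \<alpha>)) else 0)"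

text \<open>Evaluation at \<open>j + \<epsilon> v\<close>, of which only the part modulo \<open>\<epsilon>\<^sup>2\<close> matters.\<close>
definition deform :: "(nat \<Rightarrow> 'k mpoly) \<Rightarrow> 'k mpoly \<Rightarrow> 'k mpoly poly" where
  "deform v = mpoly_eval (\<lambda>c. [:Const c:]) (\<lambda>i. [:j_coord r i, v i:])"

lemma coeff_hom_poly: "coeff_hom (\<lambda>c :: 'k. [:Const c:])"
  by unfold_locales (simp_all add: Const_add Const_mult one_pCons)

lemma deform_coeff_0: "coeff (deform v F) 0 = pb F"
  by (simp add: deform_def pullback_def mpoly_eval_def poly_sum poly_prod poly_power flip: poly_0_coeff_0)

text \<open>Product rule modulo \<epsilon>-squared: the terms that differentiate
  \<open>S \<alpha>\<close> carry the factor \<open>pb (gen r \<alpha>)\<close>, which is 0. The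
  left side sees only the sum, the right side only the pulled back coefficients.\<close>

lemma deform_syzygy:
  "coeff (deform v (\<Sum>\<alpha>\<in>A. S \<alpha> * gen r \<alpha>)) 1 =
    (\<Sum>\<alpha>\<in>A. pb (S \<alpha>) * coeff (deform v (gen r \<alpha>)) 1)"
proof -
  interpret coeff_hom "\<lambda>c :: 'k. [:Const c:]" by (rule coeff_hom_poly)
  have "coeff (deform v (S \<alpha>) * deform v (gen r \<alpha>)) 1 = pb (S \<alpha>) * coeff (deform v (gen r \<alpha>)) 1"
    if "\<alpha> \<in> A" for \<alpha>
    by (simp add: coeff_mult One_nat_def deform_coeff_0 pb_gen[OF that])
  then show ?thesis
    by (simp add: deform_def eval_sum eval_mult coeff_sum)
qed

lemma deform_minor:
  "coeff (deform v (minor p q)) 1 =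
    j_coord r (p - 1) * v q + v (p - 1) * j_coord r q - j_coord r p * v (q - 1) - v p * j_coord r (q - 1)"
proof -
  interpret coeff_hom "\<lambda>c :: 'k. [:Const c:]" by (rule coeff_hom_poly)
  \<comment> \<open>Evaluation is set up over semirings and respects sums, so the subtracted product
    is first moved to the other side.\<close>
  have "deform v (minor p q) + deform v (Var p * Var (q - 1)) = deform v (Var (p - 1) * Var q)"
    by (simp add: deform_def minor_def flip: eval_add)
  then have "deform v (minor p q) = deform v (Var (p - 1) * Var q) - deform v (Var p * Var (q - 1))"
    by (simp add: eq_diff_eq)
  then show ?thesis
    by (simp add: deform_def eval_mult One_nat_def)
qed

lemma deform_Var: "coeff (deform v (Var i)) 1 = v i"
proof -
  interpret coeff_hom "\<lambda>c :: 'k. [:Const c:]" by (rule coeff_hom_poly)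
  show ?thesis by (simp add: deform_def One_nat_def)
qed

lemma j_coord_exchange:
  "1 \<le> p \<Longrightarrow> p < q \<Longrightarrow> q \<le> r \<Longrightarrow> (j_coord r p * j_coord r (q - 1) :: 'k mpoly) = j_coord r (p - 1) * j_coord r q"
proof -
  assume "1 \<le> p" "p < q" "q \<le> r"
  then have "Inl (p, q) \<in> A" by (auto simp: gen_idx_def)
  from pb_gen[OF this] show ?thesis
    by (simp add: gen_def minor_def pb_diff pb_mult pb_Var)
qed

text \<open>The reflection sending \<open>h\<close> to \<open>p + q - 1 - h\<close> permutes
  \<open>{p..q - 1}\<close>, so at most one summand contributes to a given \<open>k\<close>. As
  \<open>h + k = p + q - 1\<close>, the additional monomial makes the product independent of
  \<open>k\<close>.\<close>

lemma psi_coeff_eq: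
  assumes "1 \<le> p" "p < q" "q \<le> r"
  shows "psi_coeff r p q k * (tt ^ (r + 1 - k) * uu ^ (k + 1)) =
    (if p \<le> k \<and> k < q then j_coord r (p - 1) * j_coord r q else 0 :: 'k mpoly)"
proof (cases "p \<le> k \<and> k < q")
  case True
  let ?h = "p + q - 1 - k"
  have "(psi_coeff r p q k :: 'k mpoly) =
      (\<Sum>h\<in>{p..q - 1}. if h = ?h then tt ^ (r - h - 1) * uu ^ (h - 1) else 0)"
    unfolding psi_coeff_def using True by (intro sum.cong) auto
  also have "\<dots> = tt ^ (r - ?h - 1) * uu ^ (?h - 1)"
    using True assms by (simp add: sum.delta) linarith
  finally have "psi_coeff r p q k * (tt ^ (r + 1 - k) * uu ^ (k + 1)) =
      (tt ^ (r - ?h - 1 + (r + 1 - k)) * uu ^ (?h - 1 + (k + 1)) :: 'k mpoly)"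
    by (simp only: power_add ac_simps)
  also have "r - ?h - 1 + (r + 1 - k) = (r - (p - 1)) + (r - q)"
    using True assms by auto
  also have "?h - 1 + (k + 1) = p - 1 + q"
    using True assms by auto
  also have "tt ^ ((r - (p - 1)) + (r - q)) * uu ^ (p - 1 + q) =
      (j_coord r (p - 1) * j_coord r q :: 'k mpoly)"
  proof -
    from assms have "p - 1 \<le> r" by auto
    with assms(3) show ?thesis by (simp only: j_coord_def power_add if_True ac_simps)
  qed
  finally show ?thesis using True by simp
next
  case False
  have "p + q - 1 - h \<noteq> k" if "h \<in> {p..q - 1}" for h
    using that False assms by auto
  then have "(psi_coeff r p q k :: 'k mpoly) = 0"
    unfolding psi_coeff_def by (intro sum.neutral) auto
  with False show ?thesis by auto
qed

text \<open>
  With \<open>v i = max 0 (i - k) j\<^sub>i\<close> the first-order term of \<open>f\<^sub>p\<^sub>q\<close> is, up to a fixed monomial, the coefficient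
  of \<open>g\<^sub>k\<close> in \<open>\<psi>(e\<^sub>p \<and> e\<^sub>q)\<close>; so the deformations detect \<open>\<psi>\<close>.
\<close>
lemma psi_id_Inl:
  "psi_id r (pb_vec S) (Inl k) * to_fract (tt ^ (r + 1 - k) * uu ^ (k + 1)) =
    to_fract (coeff (deform (\<lambda>i. of_nat (i - k) * j_coord r i) (\<Sum>\<alpha>\<in>A. S \<alpha> * gen r \<alpha>)) 1)"
proof -
  let ?v = "\<lambda>i. of_nat (i - k) * j_coord r i :: 'k mpoly"
  let ?P = "{(p, q). 1 \<le> p \<and> p < q \<and> q \<le> r}" and ?T = "tt ^ (r + 1 - k) * uu ^ (k + 1) :: 'k mpoly"
  have fin: "finite ?P"
    by (rule finite_subset[of _ "{..r} \<times> {..r}"]) auto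
  have minor: "coeff (deform ?v (minor p q)) 1 = psi_coeff r p q k * ?T"
    if "1 \<le> p" "p < q" "q \<le> r" for p q
  proof -
    have "coeff (deform ?v (minor p q)) 1 =
        (of_nat (q - k) + of_nat (p - 1 - k)) * (j_coord r (p - 1) * j_coord r q)
        - (of_nat (q - 1 - k) + of_nat (p - k)) * (j_coord r p * j_coord r (q - 1))"
      by (simp only: deform_minor algebra_simps)
    also have "\<dots> = (of_nat (q - k) + of_nat (p - 1 - k) - of_nat (q - 1 - k) - of_nat (p - k))
        * (j_coord r (p - 1) * j_coord r q)"
      by (simp only: j_coord_exchange[OF that] algebra_simps)
    \<comment> \<open>The difference of \<open>q - k\<close> and \<open>q - 1 - k\<close> is 1 if
      \<open>k < q\<close> and 0 otherwise, and likewise for \<open>p\<close>; subtracting the two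
      gives the indicator of \<open>p \<le> k < q\<close>. The proof states this additively in the
      naturals, where subtraction truncates.\<close>
    also have "of_nat (q - k) + of_nat (p - 1 - k) - of_nat (q - 1 - k) - of_nat (p - k) =
        (if p \<le> k \<and> k < q then 1 else 0 :: 'k mpoly)"
    proof -
      have "q - k + (p - 1 - k) = (if p \<le> k \<and> k < q then 1 else 0) + (q - 1 - k) + (p - k)"
        using that by auto
      then have "of_nat (q - k + (p - 1 - k)) =
          (of_nat ((if p \<le> k \<and> k < q then 1 else 0) + (q - 1 - k) + (p - k)) :: 'k mpoly)" by simp
      then show ?thesis by (auto simp: algebra_simps split: if_splits)
    qed
    finally show ?thesis by (simp add: psi_coeff_eq[OF that])
  qed
  have "psi_id r (pb_vec S) (Inl k) * to_fract ?T =
      (\<Sum>x\<in>?P. to_fract (pb (S (Inl x)) * (psi_coeff r (fst x) (snd x) k * ?T)))"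
    by (auto simp: psi_id_def sum_distrib_right pb_vec_def gen_idx_def intro!: sum.cong)
  also have "\<dots> = (\<Sum>x\<in>?P. to_fract (pb (S (Inl x)) * coeff (deform ?v (gen r (Inl x))) 1))"
    by (intro sum.cong refl) (auto simp: gen_def minor)
  \<comment> \<open>The linear generators may be added to the sum: their first-order term is
    \<open>?v (r + i)\<close>, which is 0 because \<open>j_coord\<close> vanishes beyond
    \<open>r\<close>.\<close>
  also have "\<dots> = to_fract (\<Sum>\<alpha>\<in>A. pb (S \<alpha>) * coeff (deform ?v (gen r \<alpha>)) 1)"
    using fin by (simp add: gen_idx_def sum.Plus gen_def deform_Var j_coord_def)
  finally show ?thesis by (simp only: deform_syzygy)
qed

text \<open>The deformation moves off \<open>L\<close> in the direction of \<open>x_(r+i)\<close>;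
  minors involve only the coordinates of \<open>L\<close>, so only one generator has a first-order
  term.\<close>

lemma psi_id_Inr:
  assumes "i \<in> {1..n - r}"
  shows "psi_id r (pb_vec S) (Inr i) =
    to_fract (coeff (deform (\<lambda>l. if l = r + i then 1 else 0) (\<Sum>\<alpha>\<in>A. S \<alpha> * gen r \<alpha>)) 1)"
proof -
  let ?v = "\<lambda>l. if l = r + i then 1 else 0 :: 'k mpoly"
  from assms have i: "Inr i \<in> A" by (auto simp: gen_idx_def)
  have "coeff (deform ?v (gen r \<alpha>)) 1 = (if \<alpha> = Inr i then 1 else 0)" if "\<alpha> \<in> A" for \<alpha>
    using that assms by (auto simp: gen_idx_def gen_def deform_minor deform_Var split: if_splits)
  then have "(\<Sum>\<alpha>\<in>A. pb (S \<alpha>) * coeff (deform ?v (gen r \<alpha>)) 1) =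
      (\<Sum>\<alpha>\<in>A. pb (S \<alpha>) * (if \<alpha> = Inr i then 1 else 0))"
    by (intro sum.cong) auto
  also have "\<dots> = pb (S (Inr i))"
    using i by (simp add: if_distrib[of "\<lambda>c. _ * c"] cong: if_cong)
  finally show ?thesis
    using i unfolding deform_syzygy by (simp add: psi_id_def pb_vec_def)
qed

text \<open>Each component is, up to a nonzero monomial, a first-order term of a deformation of the
  sum, hence determined by the sum.\<close>

lemma psi_id_well_defined:
  assumes "(\<Sum>\<alpha>\<in>A. S \<alpha> * gen r \<alpha>) = (\<Sum>\<alpha>\<in>A. S' \<alpha> * gen r \<alpha>)" "\<beta> \<in> E_idx n r"
  shows "psi_id r (pb_vec S) \<beta> = psi_id r (pb_vec S') \<beta>"
proof (cases \<beta>)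
  case (Inl k)
  have "psi_id r (pb_vec S) (Inl k) * to_fract (tt ^ (r + 1 - k) * uu ^ (k + 1)) =
      psi_id r (pb_vec S') (Inl k) * to_fract (tt ^ (r + 1 - k) * uu ^ (k + 1))"
    by (simp only: psi_id_Inl assms(1))
  with Inl show ?thesis by simp
next
  case (Inr i)
  with assms(2) have "i \<in> {1..n - r}" by (auto simp: E_idx_def)
  with Inr show ?thesis by (simp only: psi_id_Inr assms(1))
qed

end

section \<open>The quotient ring and the matrix map on cosets\<close>

lemma finsum_poly_ring:
  "(\<And>x. x \<in> B \<Longrightarrow> f x \<in> polys n) \<Longrightarrow> finsum (poly_ring n) f B = sum f B"
proof (induction B rule: infinite_finite_induct)
  case (infinite B)
  interpret cring "poly_ring n" by (rule poly_ring_cring)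
  from infinite show ?case by (simp add: finsum_infinite)
next
  case empty
  interpret cring "poly_ring n" by (rule poly_ring_cring)
  show ?case by simp
next
  case (insert x B)
  interpret cring "poly_ring n" by (rule poly_ring_cring)
  from insert show ?case by (subst finsum_insert) auto
qed

context rational_normal_curve
begin

lemma coset_eq_iff:
  assumes "F \<in> R" "G \<in> R"
  shows "I +>\<^bsub>poly_ring n\<^esub> F = I +>\<^bsub>poly_ring n\<^esub> G \<longleftrightarrow> F - G \<in> I"
proof -
  interpret cring "poly_ring n :: 'k mpoly ring" by (rule poly_ring_cring)
  have "F \<ominus>\<^bsub>poly_ring n\<^esub> G = F - G"
    using assms minus_equality[of "- G" G] by (auto simp: a_minus_def)
  then show ?thesis
    using quotient_eq_iff_same_a_r_cos[OF ideal_I assms] by simp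
qed

lemma pullback_class_coset: "F \<in> R \<Longrightarrow> pullback_class r (I +>\<^bsub>poly_ring n\<^esub> F) = pb F"
proof -
  assume "F \<in> R"
  have "pb ` (I +>\<^bsub>poly_ring n\<^esub> F) = {pb F}"
    using I_0 by (auto simp: a_r_coset_def' pb_add pb_I image_iff)
  then show ?thesis by (simp add: pullback_class_def)
qed

text \<open>The projection to the quotient is a ring homomorphism, so the matrix product may be
  computed on representatives.\<close>

lemma nu_cosets:
  assumes "\<And>\<alpha> k. \<alpha> \<in> A \<Longrightarrow> k < b \<Longrightarrow> H \<alpha> k \<in> R \<and> N \<alpha> k = I +>\<^bsub>poly_ring n\<^esub> H \<alpha> k"
    "\<And>k. k < b \<Longrightarrow> C k \<in> R"
  shows "nu n r b N (\<lambda>k\<in>{..<b}. I +>\<^bsub>poly_ring n\<^esub> C k) =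
    (\<lambda>\<alpha>\<in>A. I +>\<^bsub>poly_ring n\<^esub> (\<Sum>k<b. H \<alpha> k * C k))"
  unfolding nu_def
proof (rule restrict_ext)
  fix \<alpha> assume \<alpha>: "\<alpha> \<in> A"
  interpret ideal I "poly_ring n" by (rule ideal_I)
  interpret hom: ring_hom_cring "poly_ring n" "coord_ring n r" "(+>\<^bsub>poly_ring n\<^esub>) I"
    by (rule rcos_ring_hom_cring[OF poly_ring_cring])
  have HC: "H \<alpha> k * C k \<in> R" if "k < b" for k
    using assms \<alpha> that by auto
  have "I +>\<^bsub>poly_ring n\<^esub> (\<Sum>k<b. H \<alpha> k * C k) =
      I +>\<^bsub>poly_ring n\<^esub> (\<Oplus>\<^bsub>poly_ring n\<^esub>k\<in>{..<b}. H \<alpha> k * C k)"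
    using HC by (subst finsum_poly_ring) auto
  also have "\<dots> = (\<Oplus>\<^bsub>coord_ring n r\<^esub>k\<in>{..<b}. I +>\<^bsub>poly_ring n\<^esub> (H \<alpha> k * C k))"
    using HC by (subst hom.hom_finsum) (auto simp: comp_def)
  also have "\<dots> = (\<Oplus>\<^bsub>coord_ring n r\<^esub>k\<in>{..<b}. N \<alpha> k \<otimes>\<^bsub>coord_ring n r\<^esub> (\<lambda>k\<in>{..<b}. I +>\<^bsub>poly_ring n\<^esub> C k) k)"
  proof (rule hom.S.finsum_cong')
    show "(\<lambda>k. N \<alpha> k \<otimes>\<^bsub>coord_ring n r\<^esub> (\<lambda>k\<in>{..<b}. I +>\<^bsub>poly_ring n\<^esub> C k) k) \<in> {..<b} \<rightarrow> carrier (coord_ring n r)"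
      using assms \<alpha> hom.hom_closed by auto
    fix k assume "k \<in> {..<b}"
    then have "H \<alpha> k \<in> R" "C k \<in> R" "N \<alpha> k = I +>\<^bsub>poly_ring n\<^esub> H \<alpha> k" "k < b"
      using assms \<alpha> by auto
    then show "I +>\<^bsub>poly_ring n\<^esub> (H \<alpha> k * C k) =
        N \<alpha> k \<otimes>\<^bsub>coord_ring n r\<^esub> (\<lambda>k\<in>{..<b}. I +>\<^bsub>poly_ring n\<^esub> C k) k"
      using hom.hom_mult[of "H \<alpha> k" "C k"] by simp
  qed simp
  finally show "(\<Oplus>\<^bsub>coord_ring n r\<^esub>k\<in>{..<b}. N \<alpha> k \<otimes>\<^bsub>coord_ring n r\<^esub> (\<lambda>k\<in>{..<b}. I +>\<^bsub>poly_ring n\<^esub> C k) k) =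
      I +>\<^bsub>poly_ring n\<^esub> (\<Sum>k<b. H \<alpha> k * C k)" ..
qed

section \<open>Linearity and degrees of \<psi>\<close>

lemma psi_id_scale: "psi_id r (\<lambda>\<alpha>. c * s \<alpha>) = (\<lambda>\<beta>. c * psi_id r s \<beta>)"
  by (auto simp: psi_id_def sum_distrib_left ac_simps split: sum.split intro!: ext sum.cong)

lemma psi_coeff_form:
  assumes "1 \<le> p" "p < q" "q \<le> r"
  shows "(psi_coeff r p q k :: 'k mpoly) \<in> forms 1 (int r - 2)"
  unfolding psi_coeff_def
proof (rule forms_sum)
  fix h assume "h \<in> {p..q - 1}"
  with assms have h: "int (r - h - 1) * 1 + int (h - 1) * 1 = int r - 2" by auto
  have "(tt :: 'k mpoly) \<in> forms 1 1" "(uu :: 'k mpoly) \<in> forms 1 1" by auto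
  from forms_mult[OF forms_power[OF this(1)] forms_power[OF this(2)] h]
  show "(if p + q - 1 - h = k then tt ^ (r - h - 1) * uu ^ (h - 1) else 0 :: 'k mpoly)
      \<in> forms 1 (int r - 2)" by simp
qed

text \<open>Degree count: \<open>r (e - 2) + (r - 2) - r e = - r - 2\<close> on the first summand
  and \<open>r (e - 1) - r e = - r\<close> on the second.\<close>

lemma psi_id_stalk:
  assumes S: "\<And>\<alpha>. \<alpha> \<in> A \<Longrightarrow> S \<alpha> \<in> forms n (e - gen_deg \<alpha>)"
    and c: "c \<in> stalk 1 (- (int r * e)) q"
  shows "psi_id r (\<lambda>\<alpha>. c * pb_vec S \<alpha>) \<in> sum_stalk (E_idx n r) (E_deg r) q"
proof -
  have vec: "pb_vec S \<alpha> \<in> stalk 1 (int r * (e - gen_deg \<alpha>)) q" for \<alpha>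
    using stalk_form[OF pb_form[OF S[of \<alpha>]]] by (auto simp: pb_vec_def)
  have "psi_id r (\<lambda>\<alpha>. c * pb_vec S \<alpha>) (Inl k) \<in> stalk 1 (- int r - 2) q" for k
    unfolding psi_id_def sum.case
  proof (rule stalk_sum, clarify)
    fix p' q' assume "1 \<le> p'" "p' < q'" "q' \<le> r"
    from stalk_form[OF psi_coeff_form[OF this]]
    show "c * pb_vec S (Inl (p', q')) * to_fract (psi_coeff r p' q' k) \<in> stalk 1 (- int r - 2) q"
      by (rule stalk_mult[OF stalk_mult[OF c vec refl]]) (simp add: gen_deg_def algebra_simps)
  qed
  moreover have "psi_id r (\<lambda>\<alpha>. c * pb_vec S \<alpha>) (Inr i) \<in> stalk 1 (- int r) q" for i
    by (auto simp: psi_id_def gen_deg_def algebra_simps intro!: stalk_mult[OF c vec])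
  moreover have "psi_id r (\<lambda>\<alpha>. c * pb_vec S \<alpha>) \<beta> = 0" if "\<beta> \<notin> E_idx n r" for \<beta>
  proof (cases \<beta>)
    case (Inl k)
    with that have k: "k \<notin> {1..r - 1}" by (auto simp: E_idx_def)
    \<comment> \<open>The indices of the basis elements occurring in \<psi> stay within
      \<open>{p'..q' - 1}\<close>, hence within \<open>{1..r - 1}\<close>.\<close>
    have "psi_coeff r p' q' k = (0 :: 'k mpoly)" if "1 \<le> p'" "p' < q'" "q' \<le> r" for p' q'
      unfolding psi_coeff_def using k that by (intro sum.neutral) auto
    with Inl show ?thesis by (auto simp: psi_id_def intro!: sum.neutral)
  next
    case (Inr i)
    with that show ?thesis by (auto simp: psi_id_def pb_vec_def E_idx_def gen_idx_def)
  qed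
  ultimately show ?thesis
    by (auto simp: sum_stalk_def E_deg_def split: sum.split)
qed

lemma finite_E_idx [simp]: "finite (E_idx n r)"
  by (simp add: E_idx_def)

section \<open>Elements of \<open>I_X\<close> as combinations of the generators of the curve\<close>

lemma I_X_ideal:
  assumes "\<And>\<alpha> k. \<alpha> \<in> A \<Longrightarrow> k < b \<Longrightarrow> M \<alpha> k \<in> R"
  shows "ideal (I_X n r b M) (poly_ring n)"
    and "F \<in> I \<Longrightarrow> G \<in> I \<Longrightarrow> F * G \<in> I_X n r b M"
    and "k < b \<Longrightarrow> (\<Sum>\<alpha>\<in>A. gen r \<alpha> * M \<alpha> k) \<in> I_X n r b M"
proof -
  interpret cring "poly_ring n :: 'k mpoly ring" by (rule poly_ring_cring)
  let ?S = "ideal_prod (poly_ring n) I I \<union> {\<Sum>\<alpha>\<in>A. gen r \<alpha> * M \<alpha> k | k. k < b}"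
  have S: "?S \<subseteq> R"
    using ideal_prod_in_carrier[OF ideal_I ideal_I] assms gen_polys
    by (auto intro!: polys_sum polys_mult)
  show "ideal (I_X n r b M) (poly_ring n)"
    unfolding I_X_def by (rule genideal_ideal[OF S])
  have sub: "?S \<subseteq> I_X n r b M"
    unfolding I_X_def by (rule genideal_self[OF S])
  show "F * G \<in> I_X n r b M" if "F \<in> I" "G \<in> I"
    using ideal_prod.prod[OF that, of "poly_ring n"] sub by auto
  show "(\<Sum>\<alpha>\<in>A. gen r \<alpha> * M \<alpha> k) \<in> I_X n r b M" if "k < b"
    using that sub by blast
qed

text \<open>
  \<open>M\<close> may be replaced by any other lifting \<open>H\<close>, since \<open>I\<^sub>C\<^sup>2\<close> absorbs the difference; a lifting whose
  entries have the degrees prescribed by \<open>N\<close> makes the generators homogeneous.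
\<close>
lemma I_X_iff:
  assumes M: "\<And>\<alpha> k. \<alpha> \<in> A \<Longrightarrow> k < b \<Longrightarrow> M \<alpha> k \<in> R"
    and H: "\<And>\<alpha> k. \<alpha> \<in> A \<Longrightarrow> k < b \<Longrightarrow> H \<alpha> k \<in> R"
    and diff: "\<And>\<alpha> k. \<alpha> \<in> A \<Longrightarrow> k < b \<Longrightarrow> M \<alpha> k - H \<alpha> k \<in> I"
  shows "F \<in> I_X n r b M \<longleftrightarrow> (\<exists>B C. (\<forall>\<alpha>\<in>A. B \<alpha> \<in> I) \<and> (\<forall>k<b. C k \<in> R) \<and>
    F = (\<Sum>\<alpha>\<in>A. (B \<alpha> + (\<Sum>k<b. H \<alpha> k * C k)) * gen r \<alpha>))" (is "_ \<longleftrightarrow> ?P F")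
proof
  interpret cring "poly_ring n :: 'k mpoly ring" by (rule poly_ring_cring)
  let ?row = "\<lambda>B C. \<Sum>\<alpha>\<in>A. (B \<alpha> + (\<Sum>k<b. H \<alpha> k * C k)) * gen r \<alpha>"
  have P: "?P F" if "\<And>\<alpha>. \<alpha> \<in> A \<Longrightarrow> B \<alpha> \<in> I" "\<And>k. k < b \<Longrightarrow> C k \<in> R" "F = ?row B C" for F B C
    using that by blast
  have add: "?P (F + G)" if "?P F" "?P G" for F G
  proof -
    from that(1) obtain B C where B: "\<forall>\<alpha>\<in>A. B \<alpha> \<in> I" "\<forall>k<b. C k \<in> R" "F = ?row B C" by blast
    from that(2) obtain B' C' where B': "\<forall>\<alpha>\<in>A. B' \<alpha> \<in> I" "\<forall>k<b. C' k \<in> R" "G = ?row B' C'" by blast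
    from B B'
    show ?thesis
      by (intro P[of "\<lambda>\<alpha>. B \<alpha> + B' \<alpha>" "\<lambda>k. C k + C' k"])
        (auto simp: sum.distrib distrib_left distrib_right ac_simps)
  qed
  have "ideal {F. ?P F} (poly_ring n)"
    unfolding ideal_poly_ring_iff
  proof (intro conjI ballI)
    show "{F. ?P F} \<subseteq> R"
      using gen_polys H I_polys by (auto intro!: polys_sum polys_add polys_mult)
    show "0 \<in> {F. ?P F}"
      using P[of "\<lambda>_. 0" "\<lambda>_. 0"] by simp
  next
    fix F G assume "F \<in> {F. ?P F}" "G \<in> {F. ?P F}"
    then show "F + G \<in> {F. ?P F}" using add by simp
  next
    fix F G assume "F \<in> {F. ?P F}" and G: "G \<in> R"
    then obtain B C where
      "\<forall>\<alpha>\<in>A. B \<alpha> \<in> I" "\<forall>k<b. C k \<in> R" "F = (\<Sum>\<alpha>\<in>A. (B \<alpha> + (\<Sum>k<b. H \<alpha> k * C k)) * gen r \<alpha>)"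
      by auto
    with G show "G * F \<in> {F. ?P F}"
      unfolding mem_Collect_eq
      by (intro P[of "\<lambda>\<alpha>. G * B \<alpha>" "\<lambda>k. G * C k"])
        (auto simp: sum_distrib_left sum_distrib_right distrib_left distrib_right ac_simps)
  qed
  moreover have "ideal_prod (poly_ring n) I I \<subseteq> {F. ?P F}"
  proof
    fix F assume "F \<in> ideal_prod (poly_ring n) I I"
    then show "F \<in> {F. ?P F}"
    proof (induction F rule: ideal_prod.induct)
      case (prod F G)
      \<comment> \<open>In a product from the square of \<open>I\<close> one factor is expanded in
        the generators and the other is moved into the coefficients, which then lie in
        \<open>I\<close>.\<close>
      then obtain S where "\<forall>\<alpha>\<in>A. S \<alpha> \<in> R" "F = (\<Sum>\<alpha>\<in>A. S \<alpha> * gen r \<alpha>)"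
        using I_C_iff[OF r_le] by blast
      with prod show ?case
        unfolding mem_Collect_eq
        by (intro P[of "\<lambda>\<alpha>. S \<alpha> * G" "\<lambda>_. 0"]) (auto simp: sum_distrib_right mult.assoc mult.commute[of G])
    qed (use add in simp)
  qed
  moreover have "{\<Sum>\<alpha>\<in>A. gen r \<alpha> * M \<alpha> k | k. k < b} \<subseteq> {F. ?P F}"
  proof clarify
    fix k assume k: "k < b"
    have "(\<Sum>l<b. H \<alpha> l * (if l = k then 1 else 0)) = H \<alpha> k" for \<alpha>
      using k by (simp add: if_distrib[of "\<lambda>c. _ * c"] cong: if_cong)
    \<comment> \<open>A unit vector selects the \<open>k\<close>-th column of \<open>H\<close>, and
      the difference to \<open>M\<close> goes into the coefficients from \<open>I\<close>.\<close>
    with k diff show "?P (\<Sum>\<alpha>\<in>A. gen r \<alpha> * M \<alpha> k)"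
      by (intro P[of "\<lambda>\<alpha>. M \<alpha> k - H \<alpha> k" "\<lambda>l. if l = k then 1 else 0"])
        (auto simp: mult.commute)
  qed
  ultimately have "I_X n r b M \<subseteq> {F. ?P F}"
    unfolding I_X_def by (intro genideal_minimal Un_least)
  then show "F \<in> I_X n r b M \<Longrightarrow> ?P F" by auto
next
  note X = I_X_ideal[of b M, OF M]
  have X_add: "F + G \<in> I_X n r b M" if "F \<in> I_X n r b M" "G \<in> I_X n r b M" for F G
    using X(1) that by (auto simp: ideal_poly_ring_iff)
  have X_mult: "G * F \<in> I_X n r b M" if "F \<in> I_X n r b M" "G \<in> R" for F G
    using X(1) that by (auto simp: ideal_poly_ring_iff)
  have X_sum: "sum f D \<in> I_X n r b M" if "\<And>x. x \<in> D \<Longrightarrow> f x \<in> I_X n r b M" for f and D :: "'x set"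
    using that
  proof (induction D rule: infinite_finite_induct)
    case (insert x D)
    then show ?case using X_add by simp
  qed (use X(1) in \<open>auto simp: ideal_poly_ring_iff\<close>)
  assume "?P F"
  then obtain B C where B: "\<And>\<alpha>. \<alpha> \<in> A \<Longrightarrow> B \<alpha> \<in> I" and C: "\<And>k. k < b \<Longrightarrow> C k \<in> R"
    and F: "F = (\<Sum>\<alpha>\<in>A. (B \<alpha> + (\<Sum>k<b. H \<alpha> k * C k)) * gen r \<alpha>)" by auto
  \<comment> \<open>Splitting \<open>H\<close> as \<open>(H - M) + M\<close>: the first sum has
    coefficients in \<open>I\<close> and lies in the square of \<open>I\<close>, the second is a
    combination of the entries of the row matrix.\<close>
  have "F = (\<Sum>\<alpha>\<in>A. (B \<alpha> + (\<Sum>k<b. (H \<alpha> k - M \<alpha> k) * C k)) * gen r \<alpha>)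
      + (\<Sum>\<alpha>\<in>A. \<Sum>k<b. C k * (gen r \<alpha> * M \<alpha> k))"
    unfolding F sum.distrib[symmetric]
    by (intro sum.cong refl) (simp add: algebra_simps sum_distrib_left sum_subtractf)
  also have "(\<Sum>\<alpha>\<in>A. \<Sum>k<b. C k * (gen r \<alpha> * M \<alpha> k)) = (\<Sum>k<b. C k * (\<Sum>\<alpha>\<in>A. gen r \<alpha> * M \<alpha> k))"
    by (subst sum.swap) (simp add: sum_distrib_left)
  also have "(\<Sum>\<alpha>\<in>A. (B \<alpha> + (\<Sum>k<b. (H \<alpha> k - M \<alpha> k) * C k)) * gen r \<alpha>) + \<dots> \<in> I_X n r b M"
  proof (intro X_add X_sum)
    fix \<alpha> assume \<alpha>: "\<alpha> \<in> A"
    have "C k * - (M \<alpha> k - H \<alpha> k) \<in> I" if "k < b" for k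
      using diff[OF \<alpha> that] C[OF that] by blast
    then have "(H \<alpha> k - M \<alpha> k) * C k \<in> I" if "k < b" for k
      using that by (simp add: mult.commute)
    then show "(B \<alpha> + (\<Sum>k<b. (H \<alpha> k - M \<alpha> k) * C k)) * gen r \<alpha> \<in> I_X n r b M"
      using \<alpha> B by (intro X(2) I_add I_sum gen_I) auto
  next
    fix k assume "k \<in> {..<b}"
    then show "C k * (\<Sum>\<alpha>\<in>A. gen r \<alpha> * M \<alpha> k) \<in> I_X n r b M"
      using X(3)[of k] C[of k] by (intro X_mult) auto
  qed
  finally show "F \<in> I_X n r b M" .
qed

end

subsection \<open>The double structure\<close>

locale presented_double_structure = rational_normal_curve n r k_type
  for n r :: nat and k_type :: "'k::field itself" +
  fixes b :: nat and a :: int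
    and \<mu> :: "(nat + nat \<Rightarrow> 'k mpoly fract) \<Rightarrow> 'k mpoly fract"
    and d :: "nat \<Rightarrow> int"
    and N :: "nat \<times> nat + nat \<Rightarrow> nat \<Rightarrow> 'k mpoly set"
    and M :: "nat \<times> nat + nat \<Rightarrow> nat \<Rightarrow> 'k mpoly"
  assumes hom: "sheaf_hom (E_idx n r) (E_deg r) (- int r - 2 + a) \<mu>"
    and presents: "presents_kernel n r \<mu> b d N"
    and lifting: "lifts n r b M N"
begin

abbreviation X :: "'k mpoly set" where "X \<equiv> I_X n r b M"

text \<open>One choice is made for all points of the projective line, so \<open>conormal\<close>
  does not refer to a point.\<close>

definition mu_coeff :: "nat + nat \<Rightarrow> 'k mpoly fract" where
  "mu_coeff = (SOME m. \<forall>q\<in>points 1. \<forall>s\<in>sum_stalk (E_idx n r) (E_deg r) q.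
     \<mu> s = (\<Sum>\<beta>\<in>E_idx n r. m \<beta> * s \<beta>))"

lemma mu_eq:
  assumes "q \<in> points 1" "s \<in> sum_stalk (E_idx n r) (E_deg r) q"
  shows "\<mu> s = (\<Sum>\<beta>\<in>E_idx n r. mu_coeff \<beta> * s \<beta>)"
proof -
  have "\<exists>m. \<forall>q\<in>points 1. \<forall>s\<in>sum_stalk (E_idx n r) (E_deg r) q.
      \<mu> s = (\<Sum>\<beta>\<in>E_idx n r. m \<beta> * s \<beta>)"
  proof (rule sheaf_hom_linear[OF finite_E_idx hom])
    fix m assume m: "\<And>q s. q \<in> points 1 \<Longrightarrow> s \<in> sum_stalk (E_idx n r) (E_deg r) q \<Longrightarrow>
      \<mu> s = (\<Sum>\<beta>\<in>E_idx n r. m \<beta> * s \<beta>)"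
    show ?thesis by (intro exI[of _ m] ballI m)
  qed
  from someI_ex[OF this] assms show ?thesis unfolding mu_coeff_def by blast
qed

text \<open>The image of \<open>\<Sum>\<^sub>\<alpha> S \<alpha> gen \<alpha>\<close> in \<open>\<L>\<close>, as a rational function.\<close>
definition conormal :: "(nat \<times> nat + nat \<Rightarrow> 'k mpoly) \<Rightarrow> 'k mpoly fract" where
  "conormal S = (\<Sum>\<beta>\<in>E_idx n r. mu_coeff \<beta> * psi_id r (pb_vec S) \<beta>)"

text \<open>The scalar \<open>c\<close> is the inverse of \<open>pb G\<close> for the stalk at a
  point of the curve, and a power of \<open>t\<close> for the twist in \<open>H0_map\<close>. It
  shifts the vector into a stalk, where \<mu> is given by \<open>mu_coeff\<close>.\<close>

lemma mu_conormal:
  assumes "\<And>\<alpha>. \<alpha> \<in> A \<Longrightarrow> S \<alpha> \<in> forms n (e - gen_deg \<alpha>)"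
    "q \<in> points 1" "c \<in> stalk 1 (- (int r * e)) q"
  shows "\<mu> (psi_id r (\<lambda>\<alpha>. c * pb_vec S \<alpha>)) = c * conormal S"
  using mu_eq[OF assms(2) psi_id_stalk[OF assms(1,3)]]
  by (simp add: psi_id_scale conormal_def sum_distrib_left mult.left_commute)

lemma conormal_well_defined:
  assumes "(\<Sum>\<alpha>\<in>A. S \<alpha> * gen r \<alpha>) = (\<Sum>\<alpha>\<in>A. S' \<alpha> * gen r \<alpha>)"
  shows "conormal S = conormal S'"
  unfolding conormal_def using psi_id_well_defined[OF assms] by (intro sum.cong) auto

lemma conormal_mult: "conormal (\<lambda>\<alpha>. F * S \<alpha>) = to_fract (pb F) * conormal S"
proof -
  have "pb_vec (\<lambda>\<alpha>. F * S \<alpha>) = (\<lambda>\<alpha>. to_fract (pb F) * pb_vec S \<alpha>)"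
    by (auto simp: pb_vec_def pb_mult)
  then show ?thesis
    by (simp add: conormal_def psi_id_scale sum_distrib_left mult.left_commute)
qed

lemma H0_map_conormal:
  assumes S: "\<And>\<alpha>. \<alpha> \<in> A \<Longrightarrow> S \<alpha> \<in> forms n (i - gen_deg \<alpha>)"
  shows "H0_map n r \<mu> i (\<lambda>\<alpha>\<in>A. I +>\<^bsub>poly_ring n\<^esub> S \<alpha>) = conormal S"
proof -
  \<comment> \<open>The point (1:0), where \<open>t\<close> is invertible, so that the power of
    \<open>t\<close> from the twist belongs to the stalk.\<close>
  let ?q = "\<lambda>i. if i = 0 then 1 else 0 :: 'k"
  have q: "?q \<in> points 1" by (auto simp: points_def)
  have "(\<lambda>\<alpha>. if \<alpha> \<in> A then to_fract (pullback_class r ((\<lambda>\<alpha>\<in>A. I +>\<^bsub>poly_ring n\<^esub> S \<alpha>) \<alpha>)) else 0) = pb_vec S"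
    by (auto simp: pb_vec_def pullback_class_coset[OF forms_polys[OF S]])
  then have "H0_map n r \<mu> i (\<lambda>\<alpha>\<in>A. I +>\<^bsub>poly_ring n\<^esub> S \<alpha>) =
      to_fract tt powi (int r * i) * (to_fract tt powi (- (int r * i)) * conormal S)"
    using mu_conormal[OF S q stalk_Var_powi[of 0 1 ?q]] by (simp add: H0_map_def twist_def)
  then show ?thesis by (simp add: power_int_minus)
qed

text \<open>An entry of \<open>M\<close> is homogeneous of some degree, which may differ from
  \<open>d k - gen_deg \<alpha>\<close> if its class is 0; this lifting has the degrees prescribed
  for \<open>N\<close>.\<close>

definition lift :: "nat \<times> nat + nat \<Rightarrow> nat \<Rightarrow> 'k mpoly" where
  "lift \<alpha> k = (SOME F. F \<in> forms n (d k - gen_deg \<alpha>) \<and> N \<alpha> k = I +>\<^bsub>poly_ring n\<^esub> F)"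

lemma lift:
  assumes "\<alpha> \<in> A" "k < b"
  shows "lift \<alpha> k \<in> forms n (d k - gen_deg \<alpha>)" "N \<alpha> k = I +>\<^bsub>poly_ring n\<^esub> lift \<alpha> k"
    "lift \<alpha> k \<in> R" "M \<alpha> k \<in> R" "M \<alpha> k - lift \<alpha> k \<in> I"
proof -
  have "N \<alpha> k \<in> coord_ring_deg n r (d k - gen_deg \<alpha>)"
    using presents assms by (auto simp: presents_kernel_def)
  then have "\<exists>F. F \<in> forms n (d k - gen_deg \<alpha>) \<and> N \<alpha> k = I +>\<^bsub>poly_ring n\<^esub> F"
    by (auto simp: coord_ring_deg_def)
  from someI_ex[OF this]
  show 1: "lift \<alpha> k \<in> forms n (d k - gen_deg \<alpha>)" "N \<alpha> k = I +>\<^bsub>poly_ring n\<^esub> lift \<alpha> k"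
    by (auto simp: lift_def)
  then show 2: "lift \<alpha> k \<in> R" by (auto dest: forms_polys)
  obtain e where M: "M \<alpha> k \<in> forms n e" "I +>\<^bsub>poly_ring n\<^esub> M \<alpha> k = N \<alpha> k"
    using lifting assms unfolding lifts_def by blast
  then show "M \<alpha> k \<in> R" by (auto dest: forms_polys)
  with M 1 2 show "M \<alpha> k - lift \<alpha> k \<in> I" by (simp flip: coset_eq_iff)
qed

section \<open>Homogeneous elements of \<open>I_X\<close> and the conormal class\<close>

lemma X_iff: "F \<in> X \<longleftrightarrow> (\<exists>B C. (\<forall>\<alpha>\<in>A. B \<alpha> \<in> I) \<and> (\<forall>k<b. C k \<in> R) \<and>
    F = (\<Sum>\<alpha>\<in>A. (B \<alpha> + (\<Sum>k<b. lift \<alpha> k * C k)) * gen r \<alpha>))"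
  using lift by (intro I_X_iff) auto

lemma ideal_X: "ideal X (poly_ring n)"
  using lift by (intro I_X_ideal) auto

lemma X_product: "F \<in> I \<Longrightarrow> G \<in> I \<Longrightarrow> F * G \<in> X"
  using lift by (intro I_X_ideal) auto

lemma X_mult: "F \<in> X \<Longrightarrow> G \<in> R \<Longrightarrow> G * F \<in> X"
  using ideal_X by (auto simp: ideal_poly_ring_iff)

lemma X_polys: "F \<in> X \<Longrightarrow> F \<in> R"
  using ideal_X by (auto simp: ideal_poly_ring_iff)

lemma X_sum: "(\<And>x. x \<in> B \<Longrightarrow> F x \<in> X) \<Longrightarrow> sum F B \<in> X"
  using ideal_X by (induction B rule: infinite_finite_induct) (auto simp: ideal_poly_ring_iff)

lemma X_subset_I: "F \<in> X \<Longrightarrow> F \<in> I"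
  unfolding X_iff using lift gen_I I_polys
  by (auto intro!: I_sum I_mult polys_add polys_sum polys_mult)

text \<open>Since \<open>lift \<alpha> k\<close> and \<open>gen r \<alpha>\<close> together have
  degree \<open>d k\<close> for every \<alpha>, cutting \<open>C k\<close> down to degree
  \<open>e - d k\<close> extracts the part of degree \<open>e\<close> in all summands at
  once.\<close>

lemma X_hcomp:
  assumes "F \<in> X"
  shows "\<exists>B C. (\<forall>\<alpha>\<in>A. B \<alpha> \<in> I \<inter> forms n (e - gen_deg \<alpha>)) \<and> (\<forall>k<b. C k \<in> forms n (e - d k)) \<and>
    hcomp e F = (\<Sum>\<alpha>\<in>A. (B \<alpha> + (\<Sum>k<b. lift \<alpha> k * C k)) * gen r \<alpha>)"
proof -
  obtain B C where B: "\<And>\<alpha>. \<alpha> \<in> A \<Longrightarrow> B \<alpha> \<in> I" and C: "\<And>k. k < b \<Longrightarrow> C k \<in> R"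
    and F: "F = (\<Sum>\<alpha>\<in>A. (B \<alpha> + (\<Sum>k<b. lift \<alpha> k * C k)) * gen r \<alpha>)"
    using assms unfolding X_iff by blast
  have summand: "hcomp e ((B \<alpha> + (\<Sum>k<b. lift \<alpha> k * C k)) * gen r \<alpha>) =
      (hcomp (e - gen_deg \<alpha>) (B \<alpha>) + (\<Sum>k<b. lift \<alpha> k * hcomp (e - d k) (C k))) * gen r \<alpha>"
    if \<alpha>: "\<alpha> \<in> A" for \<alpha>
  proof -
    have "hcomp (e - gen_deg \<alpha>) (lift \<alpha> k * C k) = lift \<alpha> k * hcomp (e - d k) (C k)" if "k < b" for k
      using hcomp_mult[OF lift(1)[OF \<alpha> that] C[OF that], of "e - gen_deg \<alpha>"]
      by (simp add: mult.commute)
    then have "hcomp (e - gen_deg \<alpha>) (\<Sum>k<b. lift \<alpha> k * C k) = (\<Sum>k<b. lift \<alpha> k * hcomp (e - d k) (C k))"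
      by (simp add: hcomp_sum)
    moreover have "B \<alpha> + (\<Sum>k<b. lift \<alpha> k * C k) \<in> R"
      using I_polys[OF B[OF \<alpha>]] C lift(3)[OF \<alpha>] by (intro polys_add polys_sum polys_mult) auto
    ultimately show ?thesis
      by (simp add: hcomp_mult[OF gen_forms[OF r_le \<alpha>]] hcomp_add)
  qed
  show ?thesis
  proof (intro exI conjI ballI allI impI)
    show "hcomp (e - gen_deg \<alpha>) (B \<alpha>) \<in> I \<inter> forms n (e - gen_deg \<alpha>)" if "\<alpha> \<in> A" for \<alpha>
      using B[OF that] by (auto intro: I_polys)
    show "hcomp (e - d k) (C k) \<in> forms n (e - d k)" if "k < b" for k
      using C[OF that] by auto
    show "hcomp e F = (\<Sum>\<alpha>\<in>A. (hcomp (e - gen_deg \<alpha>) (B \<alpha>) +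
        (\<Sum>k<b. lift \<alpha> k * hcomp (e - d k) (C k))) * gen r \<alpha>)"
      by (simp add: F hcomp_sum summand)
  qed
qed

lemma hcomp_X: "F \<in> X \<Longrightarrow> hcomp e F \<in> X"
  using X_hcomp[of F e] forms_polys unfolding X_iff[of "hcomp e F"] by blast

lemma homogeneous_ideal_X: "homogeneous_ideal n X"
  by (simp add: homogeneous_ideal_def ideal_X hom_comp_hcomp hcomp_X)

text \<open>This is the equality of the image of \<open>nu\<close> with the kernel of
  \<open>H0_map\<close> in degree \<open>e\<close>, with classes replaced by homogeneous
  representatives.\<close>

lemma conormal_eq_0_iff:
  assumes S: "\<And>\<alpha>. \<alpha> \<in> A \<Longrightarrow> S \<alpha> \<in> forms n (e - gen_deg \<alpha>)"
  shows "conormal S = 0 \<longleftrightarrow>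
    (\<exists>C. (\<forall>k<b. C k \<in> forms n (e - d k)) \<and> (\<forall>\<alpha>\<in>A. S \<alpha> - (\<Sum>k<b. lift \<alpha> k * C k) \<in> I))"
proof -
  let ?c = "\<lambda>\<alpha>\<in>A. I +>\<^bsub>poly_ring n\<^esub> S \<alpha>"
  let ?D = "\<Pi>\<^sub>E k\<in>{..<b}. coord_ring_deg n r (e - d k) :: 'k mpoly set set"
  have nu: "nu n r b N (\<lambda>k\<in>{..<b}. I +>\<^bsub>poly_ring n\<^esub> C k) =
      (\<lambda>\<alpha>\<in>A. I +>\<^bsub>poly_ring n\<^esub> (\<Sum>k<b. lift \<alpha> k * C k))"
    if "\<forall>k<b. C k \<in> forms n (e - d k)" for C
    using that lift by (intro nu_cosets) (auto dest: forms_polys)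
  have eq: "?c = (\<lambda>\<alpha>\<in>A. I +>\<^bsub>poly_ring n\<^esub> (\<Sum>k<b. lift \<alpha> k * C k)) \<longleftrightarrow>
      (\<forall>\<alpha>\<in>A. S \<alpha> - (\<Sum>k<b. lift \<alpha> k * C k) \<in> I)"
    if C: "\<forall>k<b. C k \<in> forms n (e - d k)" for C
  proof -
    have "(\<Sum>k<b. lift \<alpha> k * C k) \<in> R" if "\<alpha> \<in> A" for \<alpha>
      using forms_polys C lift(3)[OF that] by (intro polys_sum polys_mult) blast+
    then show ?thesis
      using forms_polys[OF S] by (auto simp: fun_eq_iff restrict_def coset_eq_iff)
  qed
  have c: "?c \<in> source_deg n r e"
    using S by (auto simp: source_deg_def coord_ring_deg_def)
  \<comment> \<open>Each coordinate has a homogeneous representative, so a vector in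
    \<open>?D\<close> may be replaced by a family of forms.\<close>
  have D: "?D = (\<lambda>C. \<lambda>k\<in>{..<b}. I +>\<^bsub>poly_ring n\<^esub> C k) ` {C. \<forall>k<b. C k \<in> forms n (e - d k)}"
  proof (intro equalityI subsetI)
    fix c' assume c': "c' \<in> ?D"
    have "\<exists>F. F \<in> forms n (e - d k) \<and> c' k = I +>\<^bsub>poly_ring n\<^esub> F" if "k < b" for k
      using PiE_mem[OF c', of k] that by (auto simp: coord_ring_deg_def)
    then obtain C where C: "\<And>k. k < b \<Longrightarrow> C k \<in> forms n (e - d k)"
      "\<And>k. k < b \<Longrightarrow> c' k = I +>\<^bsub>poly_ring n\<^esub> C k"
      by metis
    have "c' = (\<lambda>k\<in>{..<b}. I +>\<^bsub>poly_ring n\<^esub> C k)"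
      using c' C(2) by (intro extensionalityI[of _ "{..<b}"]) (auto simp: PiE_def)
    with C(1) show "c' \<in> (\<lambda>C. \<lambda>k\<in>{..<b}. I +>\<^bsub>poly_ring n\<^esub> C k) ` {C. \<forall>k<b. C k \<in> forms n (e - d k)}"
      by (intro image_eqI[of _ _ C]) auto
  qed (auto simp: coord_ring_deg_def)
  have "conormal S = 0 \<longleftrightarrow> ?c \<in> {c \<in> source_deg n r e. H0_map n r \<mu> e c = 0}"
    using c by (simp add: H0_map_conormal[OF S])
  also have "\<dots> \<longleftrightarrow> ?c \<in> nu n r b N ` ?D"
    using presents by (simp add: presents_kernel_def)
  also have "\<dots> \<longleftrightarrow> (\<exists>C. (\<forall>k<b. C k \<in> forms n (e - d k)) \<and>
      ?c = (\<lambda>\<alpha>\<in>A. I +>\<^bsub>poly_ring n\<^esub> (\<Sum>k<b. lift \<alpha> k * C k)))"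
    unfolding D image_image image_iff mem_Collect_eq Bex_def by (intro ex_cong1 conj_cong refl) (simp only: nu)
  also have "\<dots> \<longleftrightarrow> (\<exists>C. (\<forall>k<b. C k \<in> forms n (e - d k)) \<and> (\<forall>\<alpha>\<in>A. S \<alpha> - (\<Sum>k<b. lift \<alpha> k * C k) \<in> I))"
    using eq by (intro ex_cong1 conj_cong refl)
  finally show ?thesis .
qed

text \<open>If the form lies in \<open>X\<close>, its degree \<open>e\<close> expansion there has
  class 0 by the kernel criterion, and the class does not depend on the expansion. Conversely the
  criterion writes \<open>S\<close> as a combination of columns plus a remainder in
  \<open>I\<close>.\<close>

lemma X_form_iff:
  assumes S: "\<And>\<alpha>. \<alpha> \<in> A \<Longrightarrow> S \<alpha> \<in> forms n (e - gen_deg \<alpha>)"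
  shows "(\<Sum>\<alpha>\<in>A. S \<alpha> * gen r \<alpha>) \<in> X \<longleftrightarrow> conormal S = 0"
proof
  let ?F = "\<Sum>\<alpha>\<in>A. S \<alpha> * gen r \<alpha>"
  have F: "?F \<in> forms n e"
    using gen_forms[OF r_le] S by (intro forms_sum forms_mult[OF S]) auto
  assume "?F \<in> X"
  then obtain B C where B: "\<And>\<alpha>. \<alpha> \<in> A \<Longrightarrow> B \<alpha> \<in> I \<inter> forms n (e - gen_deg \<alpha>)"
    and C: "\<And>k. k < b \<Longrightarrow> C k \<in> forms n (e - d k)"
    and eq: "hcomp e ?F = (\<Sum>\<alpha>\<in>A. (B \<alpha> + (\<Sum>k<b. lift \<alpha> k * C k)) * gen r \<alpha>)"
    using X_hcomp[of ?F e] by blast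
  let ?S = "\<lambda>\<alpha>. B \<alpha> + (\<Sum>k<b. lift \<alpha> k * C k)"
  have "?S \<alpha> \<in> forms n (e - gen_deg \<alpha>)" if "\<alpha> \<in> A" for \<alpha>
    using B[OF that] by (auto intro!: forms_add forms_sum forms_mult[OF lift(1)[OF that] C])
  then have "conormal ?S = 0"
    using B C by (subst conormal_eq_0_iff[where e = e]) (auto intro!: exI[of _ C])
  moreover have "conormal S = conormal ?S"
    using eq by (intro conormal_well_defined) (simp add: hcomp_form[OF F])
  ultimately show "conormal S = 0" by simp
next
  assume "conormal S = 0"
  then obtain C where C: "\<And>k. k < b \<Longrightarrow> C k \<in> forms n (e - d k)"
    "\<And>\<alpha>. \<alpha> \<in> A \<Longrightarrow> S \<alpha> - (\<Sum>k<b. lift \<alpha> k * C k) \<in> I"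
    using conormal_eq_0_iff[OF S] by blast
  then show "(\<Sum>\<alpha>\<in>A. S \<alpha> * gen r \<alpha>) \<in> X"
    unfolding X_iff
    by (intro exI[of _ "\<lambda>\<alpha>. S \<alpha> - (\<Sum>k<b. lift \<alpha> k * C k)"] exI[of _ C]) (auto dest: forms_polys)
qed

section \<open>Stalks of the ideal sheaf, on and off the curve\<close>

lemma ideal_stalk_X:
  assumes P: "P \<in> points n"
  shows "ideal_stalk n X P = double_structure n r \<mu> P"
proof (cases "P \<in> rnc n r")
  case True
  obtain q where q: "q \<in> points 1"
    "\<And>G e. G \<in> forms n e \<Longrightarrow> eval_at P G \<noteq> 0 \<Longrightarrow> eval_at q (pb G) \<noteq> 0"
    using rnc_denominator[OF True] by blast
  \<comment> \<open>The class of the fraction is \<open>conormal S\<close> divided by the nonzero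
    \<open>pb G\<close>, so the kernel condition concerns the numerator alone.\<close>
  have mu: "\<mu> (psi_id r (\<lambda>\<alpha>. if \<alpha> \<in> A then to_fract (pb (S \<alpha>)) / to_fract (pb G) else 0)) = 0
      \<longleftrightarrow> (\<Sum>\<alpha>\<in>A. S \<alpha> * gen r \<alpha>) \<in> X"
    if S: "\<And>\<alpha>. \<alpha> \<in> A \<Longrightarrow> S \<alpha> \<in> forms n (e - gen_deg \<alpha>)"
      and G: "G \<in> forms n e" "eval_at P G \<noteq> 0" for S G e
  proof -
    have nz: "eval_at q (pb G) \<noteq> 0" "pb G \<noteq> 0"
      using q(2)[OF G] by auto
    have "(\<lambda>\<alpha>. if \<alpha> \<in> A then to_fract (pb (S \<alpha>)) / to_fract (pb G) else 0) =
        (\<lambda>\<alpha>. 1 / to_fract (pb G) * pb_vec S \<alpha>)"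
      by (auto simp: pb_vec_def)
    then show ?thesis
      using mu_conormal[OF S q(1) stalk_inverse[OF pb_form[OF G(1)] nz(1)]] nz(2) X_form_iff[OF S]
      by simp
  qed
  show ?thesis
  proof (intro equalityI subsetI)
    fix s assume "s \<in> ideal_stalk n X P"
    then obtain F G e where s: "s = to_fract F / to_fract G" "F \<in> X" "F \<in> forms n e"
      "G \<in> forms n e" "eval_at P G \<noteq> 0"
      by (auto simp: ideal_stalk_def)
    obtain S where S: "\<And>\<alpha>. \<alpha> \<in> A \<Longrightarrow> S \<alpha> \<in> forms n (e - gen_deg \<alpha>)" "F = (\<Sum>\<alpha>\<in>A. S \<alpha> * gen r \<alpha>)"
      using I_form_expansion[OF X_subset_I[OF s(2)] s(3)] by metis
    show "s \<in> double_structure n r \<mu> P"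
      unfolding double_structure_def if_P[OF True] mem_Collect_eq
      using s S mu[OF S(1) s(4,5)]
      by (intro exI[of _ S] exI[of _ G] exI[of _ e]) auto
  next
    fix s assume "s \<in> double_structure n r \<mu> P"
    then obtain S G e where s: "s = to_fract (\<Sum>\<alpha>\<in>A. S \<alpha> * gen r \<alpha>) / to_fract G"
      "\<And>\<alpha>. \<alpha> \<in> A \<Longrightarrow> S \<alpha> \<in> forms n (e - gen_deg \<alpha>)" "G \<in> forms n e" "eval_at P G \<noteq> 0"
      "\<mu> (psi_id r (\<lambda>\<alpha>. if \<alpha> \<in> A then to_fract (pb (S \<alpha>)) / to_fract (pb G) else 0)) = 0"
      unfolding double_structure_def if_P[OF True] by blast
    moreover have "(\<Sum>\<alpha>\<in>A. S \<alpha> * gen r \<alpha>) \<in> X"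
      using mu[OF s(2-4)] s(5) by simp
    moreover have "(\<Sum>\<alpha>\<in>A. S \<alpha> * gen r \<alpha>) \<in> forms n e"
      using gen_forms[OF r_le] by (intro forms_sum forms_mult[OF s(2)]) auto
    ultimately show "s \<in> ideal_stalk n X P"
      unfolding ideal_stalk_def by blast
  qed
next
  case False
  obtain \<alpha> where \<alpha>: "\<alpha> \<in> A" "eval_at P (gen r \<alpha>) \<noteq> 0"
    using zeros_in_rnc[OF P] False by blast
  \<comment> \<open>As a square of a generator this form lies in \<open>X\<close>, and it is nonzero
    at \<open>P\<close>; expanding a fraction by it moves the numerator into
    \<open>X\<close>.\<close>
  let ?g = "gen r \<alpha> * gen r \<alpha> :: 'k mpoly"
  have g: "?g \<in> X" "?g \<in> forms n (2 * gen_deg \<alpha>)" "eval_at P ?g \<noteq> 0"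
    using \<alpha> X_product gen_I forms_mult[OF gen_forms[OF r_le \<alpha>(1)] gen_forms[OF r_le \<alpha>(1)]]
    by (auto simp: eval_at_mult)
  have "stalk n 0 P \<subseteq> ideal_stalk n X P"
  proof
    fix s assume "s \<in> stalk n 0 P"
    then obtain F G e where s: "s = to_fract F / to_fract G" "F \<in> forms n (e + 0)" "G \<in> forms n e"
      "eval_at P G \<noteq> 0"
      by (rule stalkE)
    have "s = to_fract (F * ?g) / to_fract (G * ?g)"
      using g(3) by (auto simp: s(1))
    moreover have "F * ?g \<in> X"
      using X_mult[OF g(1) forms_polys[OF s(2)]] .
    moreover have "F * ?g \<in> forms n (e + 2 * gen_deg \<alpha>)" "G * ?g \<in> forms n (e + 2 * gen_deg \<alpha>)"
      using forms_mult[OF s(2) g(2)] forms_mult[OF s(3) g(2)] by auto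
    moreover have "eval_at P (G * ?g) \<noteq> 0"
      using s(4) g(3) by (simp add: eval_at_mult)
    ultimately show "s \<in> ideal_stalk n X P"
      unfolding ideal_stalk_def by blast
  qed
  moreover have "ideal_stalk n X P \<subseteq> stalk n 0 P"
    by (auto simp: ideal_stalk_def intro: stalkI[where d = 0, simplified])
  ultimately show ?thesis
    using False by (auto simp: double_structure_def)
qed

text \<open>
  Multiplication by \<open>x\<^sub>0\<close> pulls back to multiplication by \<open>t\<^sup>r\<close>, a nonzerodivisor on \<open>K[t,u]\<close> and on \<open>\<L>\<close>:
  it preserves both conditions cutting \<open>I\<^sub>X\<close> out of \<open>R\<close>, \<open>j\<^sup>*F = 0\<close> and the vanishing of the class in \<open>\<L>\<close>.
\<close>
lemma X_cancel_Var:
  assumes F: "F \<in> forms n e" and "Var 0 ^ k * F \<in> X"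
  shows "F \<in> X"
proof -
  have pb0: "pb (Var 0 ^ k) \<noteq> 0"
    by (simp add: pb_power pb_Var j_coord_def)
  have "pb (Var 0 ^ k * F) = 0"
    using assms X_subset_I pb_I by blast
  with pb0 have "pb F = 0" by (simp add: pb_mult)
  then have "F \<in> I"
    using I_iff_pb[OF forms_polys[OF F]] by simp
  then obtain S where S: "\<And>\<alpha>. \<alpha> \<in> A \<Longrightarrow> S \<alpha> \<in> forms n (e - gen_deg \<alpha>)"
    and FS: "F = (\<Sum>\<alpha>\<in>A. S \<alpha> * gen r \<alpha>)"
    using I_form_expansion[OF _ F] by blast
  have x: "Var 0 ^ k \<in> forms n (int k)"
    using forms_power[OF forms_Var[of 0 n], of k] by simp
  have "Var 0 ^ k * S \<alpha> \<in> forms n ((int k + e) - gen_deg \<alpha>)" if "\<alpha> \<in> A" for \<alpha>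
    by (rule forms_mult[OF x S[OF that]]) simp
  then have "conormal (\<lambda>\<alpha>. Var 0 ^ k * S \<alpha>) = 0"
    using assms(2) by (subst X_form_iff[symmetric]) (auto simp: FS sum_distrib_left mult.assoc)
  with pb0 have "conormal S = 0" by (simp add: conormal_mult)
  then show ?thesis using X_form_iff[OF S] FS by simp
qed

text \<open>As \<open>X\<close> is homogeneous, it contains the components of
  \<open>Var 0 ^ k * F\<close>; these are \<open>Var 0 ^ k\<close> times the components of
  \<open>F\<close>, to which the cancellation for forms applies.\<close>

lemma saturated_X: "saturated n X"
  unfolding saturated_def
proof (intro equalityI subsetI)
  fix F assume "F \<in> X"
  then show "F \<in> saturation n X"
    by (auto simp: saturation_def X_polys intro!: exI[of _ 0])
next
  fix F assume "F \<in> saturation n X"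
  then obtain k where F: "F \<in> R" and k: "Var 0 ^ k * F \<in> X"
    by (auto simp: saturation_def)
  have x: "Var 0 ^ k \<in> forms n (int k)"
    using forms_power[OF forms_Var[of 0 n], of k] by simp
  have "hcomp e F \<in> X" for e
  proof (rule X_cancel_Var)
    show "hcomp e F \<in> forms n e" using F by blast
    have "Var 0 ^ k * hcomp e F = hcomp (e + int k) (Var 0 ^ k * F)"
      using hcomp_mult[OF x F, of "e + int k"] by (simp add: mult.commute)
    then show "Var 0 ^ k * hcomp e F \<in> X" using hcomp_X[OF k] by simp
  qed
  then show "F \<in> X"
    by (metis sum_hcomp X_sum)
qed

end

theorem proposition2p10:
  fixes n r b :: nat and a :: int
    and \<mu> :: "(nat + nat \<Rightarrow> 'k::{alg_closed_field, field_char_0} mpoly fract) \<Rightarrow> 'k mpoly fract"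
    and d :: "nat \<Rightarrow> int"
    and N :: "nat \<times> nat + nat \<Rightarrow> nat \<Rightarrow> 'k mpoly set"
    and M :: "nat \<times> nat + nat \<Rightarrow> nat \<Rightarrow> 'k mpoly"
  assumes "1 \<le> r" and "r \<le> n"
    and "sheaf_hom (E_idx n r) (E_deg r) (- int r - 2 + a) \<mu>"
    and "sheaf_surj (E_idx n r) (E_deg r) (- int r - 2 + a) \<mu>"
    and "presents_kernel n r \<mu> b d N"
    and "lifts n r b M N"
  shows "homogeneous_ideal n (I_X n r b M)
    \<and> (\<forall>P\<in>points n. ideal_stalk n (I_X n r b M) P = double_structure n r \<mu> P)
    \<and> saturated n (I_X n r b M)"
proof -
  interpret presented_double_structure n r "TYPE('k)" b a \<mu> d N M
    using assms by unfold_locales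
  show ?thesis
    by (simp add: homogeneous_ideal_X ideal_stalk_X saturated_X)
qed

end
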